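(* Let $r\ge 0$ be a real number and let $\varphi,\psi:X\to Y$ be $r$-homotopic short maps of quasimetric spaces. Then they induce equal morphisms on $r$-spectral homology: $$\mathrm{SH}^r_{n,I}(\varphi)=\mathrm{SH}^r_{n,I}(\psi):\mathrm{SH}^r_{n,I}(X)\longrightarrow \mathrm{SH}^r_{n,I}(Y)$$ for any natural number $n$ and any non-empty interval $I\subseteq\mathbb R$.
   Context: Quasimetric spaces. A quasimetric space is a set $X$ with $d:X\times X\to[0,+\infty]$ satisfying the triangle inequality and $d(x,y)=0\iff x=y$ (not necessarily symmetric). A map $\varphi:X\to Y$ is short if $d(\varphi(x),\varphi(x'))\le d(x,x')$. Short maps $X\to Y$ form a quasimetric space with $d(\varphi,\psi)=\sup_x d(\varphi(x),\psi(x))$. For real $r\ge0$, two short maps are $r$-homotopic if they are related by the smallest equivalence relation $\sim_r$ on short maps $X\to Y$ such that $d(\varphi,\psi)\le r$ implies $\varphi\sim_r\psi$. Intervals. An interval is a convex subset of $\mathbb R$. Every non-empty interval is uniquely $I=R_I\setminus L_I$ with $R_I=\{s\in\mathbb R\mid\exists i\in I,\ s\le i\}$ and $L_I=\{s\in\mathbb R\mid\forall i\in I,\ s<i\}$. For real $r\ge0$ put $I_{-r}=R_I\setminus(L_I-r)$ and $I^{+r}=(R_I+r)\setminus L_I$. Spectral homology. Let $\mathbb K$ be a commutative ring. An $\mathbb R$-filtered chain complex $C$ over $\mathbb K$ has subcomplexes $F_sC$, $s\in\mathbb R$, with $F_sC\subseteq F_{s'}C$ for $s<s'$. For a downward closed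 subset $L\subseteq \mathbb R$ put $F_LC=\bigcup_{s\in L}F_sC$ (zero if $L=\emptyset$), and for a non-empty interval $I$ put $C_I=F_{R_I}C/F_{L_I}C$. Inclusions induce maps $C_{I_{-r}}\to C_I\to C_{I^{+r}}$. Set $\mathrm{SZ}^r_{n,I}(C)=\mathrm{Im}(H_n(C_{I_{-r}})\to H_n(C_I))$ and $\mathrm{SB}^r_{n,I}(C)=\mathrm{Ker}(H_n(C_I)\to H_n(C_{I^{+r}}))$; one has $\mathrm{SB}^r_{n,I}(C)\subseteq\mathrm{SZ}^r_{n,I}(C)$, and $\mathrm{SH}^r_{n,I}(C)=\mathrm{SZ}^r_{n,I}(C)/\mathrm{SB}^r_{n,I}(C)\cong\mathrm{Im}(H_n(C_{I_{-r}})\to H_n(C_{I^{+r}}))$. This is functorial in filtration-preserving chain maps. For a quasimetric space $X$, $\mathrm{RC}(X)$ is the chain complex with $\mathrm{RC}_n(X)$ the free $\mathbb K$-module on tuples $(x_0,\dots,x_n)$ with $x_i\ne x_{i+1}$ and $d(x_i,x_{i+1})<+\infty$, differential $\partial(x_0,\dots,x_n)=\sum_{i=0}^n(-1)^i(x_0,\dots,\hat x_i,\dots,x_n)$, where tuples with a consecutive repetition are set equal to $0$. $F_s\mathrm{RC}(X)$ is spanned by tuples with $\sum_i d(x_i,x_{i+1})\le s$. A short map $\varphi$ induces $\mathrm{RC}(\varphi):(x_0,\dots,x_n)\mapsto(\varphi(x_0),\dots,\varphi(x_n))$. Define $\mathrm{SH}^r_{n,I}(X)=\mathrm{SH}^r_{n,I}(\mathrm{RC}(X))$,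 which is a functor from quasimetric spaces with short maps to $\mathbb K$-modules. *)

theory Defs
  imports
    "HOL-Analysis.Convex"
    "HOL-Library.Extended_Nonnegative_Real"
    "HOL-Algebra.Module"
    "HOL-Algebra.AbelCoset"
begin

section \<open>Quasimetric spaces\<close>

locale quasimetric_space =
  fixes X :: "'a set" and d :: "'a \<Rightarrow> 'a \<Rightarrow> ennreal"
  assumes triangle: "\<lbrakk>x \<in> X; y \<in> X; z \<in> X\<rbrakk> \<Longrightarrow> d x z \<le> d x y + d y z"
    and dist_eq_0_iff: "\<lbrakk>x \<in> X; y \<in> X\<rbrakk> \<Longrightarrow> d x y = 0 \<longleftrightarrow> x = y"

definition short_maps ::
  "'a set \<Rightarrow> ('a \<Rightarrow> 'a \<Rightarrow> ennreal) \<Rightarrow> 'b set \<Rightarrow> ('b \<Rightarrow> 'b \<Rightarrow> ennreal) \<Rightarrow> ('a \<Rightarrow> 'b) set" where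
  "short_maps X dX Y dY =
     {\<phi> \<in> X \<rightarrow>\<^sub>E Y. \<forall>x\<in>X. \<forall>x'\<in>X. dY (\<phi> x) (\<phi> x') \<le> dX x x'}"

definition map_dist :: "'a set \<Rightarrow> ('b \<Rightarrow> 'b \<Rightarrow> ennreal) \<Rightarrow> ('a \<Rightarrow> 'b) \<Rightarrow> ('a \<Rightarrow> 'b) \<Rightarrow> ennreal" where
  "map_dist X dY \<phi> \<psi> = (SUP x\<in>X. dY (\<phi> x) (\<psi> x))"

definition homotopy_rel ::
  "real \<Rightarrow> 'a set \<Rightarrow> ('a \<Rightarrow> 'a \<Rightarrow> ennreal) \<Rightarrow> 'b set \<Rightarrow> ('b \<Rightarrow> 'b \<Rightarrow> ennreal)
     \<Rightarrow> (('a \<Rightarrow> 'b) \<times> ('a \<Rightarrow> 'b)) set" where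
  "homotopy_rel r X dX Y dY =
     \<Inter> {E. equiv (short_maps X dX Y dY) E \<and>
          (\<forall>\<phi>\<in>short_maps X dX Y dY. \<forall>\<psi>\<in>short_maps X dX Y dY.
             map_dist X dY \<phi> \<psi> \<le> ennreal r \<longrightarrow> (\<phi>, \<psi>) \<in> E)}"


section \<open>Intervals\<close>

definition interval_R :: "real set \<Rightarrow> real set" where
  "interval_R I = {s. \<exists>i\<in>I. s \<le> i}"

definition interval_L :: "real set \<Rightarrow> real set" where
  "interval_L I = {s. \<forall>i\<in>I. s < i}"

definition interval_minus :: "real set \<Rightarrow> real \<Rightarrow> real set" where
  "interval_minus I r = interval_R I - (\<lambda>s. s - r) ` interval_L I"

definition interval_plus :: "real set \<Rightarrow> real \<Rightarrow> real set" where
  "interval_plus I r = (\<lambda>s. s + r) ` interval_R I - interval_L I"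


section \<open>Quotient modules and chain complexes\<close>

text \<open>
  Module records extend ring records; the multiplicative fields \<open>mult\<close> and \<open>one\<close> play no
  role for modules and are left undefined. In \<open>quot_module\<close> and \<open>quot_map\<close>, the union over
  all representatives of a coset is the single coset that each of them yields, provided the
  operation is well defined on cosets.
\<close>

definition quot_module :: "('k, 'v, 'm) module_scheme \<Rightarrow> 'v set \<Rightarrow> ('k, 'v set) module" where
  "quot_module M N =
     \<lparr>carrier = a_rcosets\<^bsub>M\<^esub> N, monoid.mult = undefined, one = undefined,
      zero = N, add = (\<lambda>A B. A <+>\<^bsub>M\<^esub> B),
      smult = (\<lambda>a A. \<Union>x\<in>A. N +>\<^bsub>M\<^esub> (a \<odot>\<^bsub>M\<^esub> x))\<rparr>"

text \<open>The map \<open>M / N \<rightarrow> M' / N'\<close> induced by a linear map \<open>f : M \<rightarrow> M'\<close> with \<open>f(N) \<subseteq> N'\<close>.\<close>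

definition quot_map ::
  "('k, 'w, 'm) module_scheme \<Rightarrow> 'w set \<Rightarrow> ('v \<Rightarrow> 'w) \<Rightarrow> 'v set \<Rightarrow> 'w set" where
  "quot_map M' N' f A = (\<Union>x\<in>A. N' +>\<^bsub>M'\<^esub> f x)"

text \<open>
  Chain complexes are concentrated in degrees \<open>n \<ge> 0\<close>. The differential \<open>bd C n\<close> goes from
  \<open>ob C n\<close> to \<open>ob C (n - 1)\<close>; as \<open>0 - 1 = 0\<close> on naturals, the convention is that \<open>bd C 0\<close>
  is the zero map, so that every element of degree \<open>0\<close> is a cycle.
\<close>

record ('k, 'v) chain_complex =
  ob :: "nat \<Rightarrow> ('k, 'v) module"
  bd :: "nat \<Rightarrow> 'v \<Rightarrow> 'v"

record ('k, 'v) filtered_complex = "('k, 'v) chain_complex" +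
  filt :: "real \<Rightarrow> nat \<Rightarrow> 'v set"

definition cycles :: "('k, 'v, 'm) chain_complex_scheme \<Rightarrow> nat \<Rightarrow> 'v set" where
  "cycles C n = a_kernel (ob C n) (ob C (n - 1)) (bd C n)"

definition boundaries :: "('k, 'v, 'm) chain_complex_scheme \<Rightarrow> nat \<Rightarrow> 'v set" where
  "boundaries C n = bd C (Suc n) ` carrier (ob C (Suc n))"

definition homology :: "('k, 'v, 'm) chain_complex_scheme \<Rightarrow> nat \<Rightarrow> ('k, 'v set) module" where
  "homology C n = quot_module (ob C n\<lparr>carrier := cycles C n\<rparr>) (boundaries C n)"

definition homology_map ::
  "('k, 'w, 'm) chain_complex_scheme \<Rightarrow> nat \<Rightarrow> (nat \<Rightarrow> 'v \<Rightarrow> 'w) \<Rightarrow> 'v set \<Rightarrow> 'w set" where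
  "homology_map C' n f = quot_map (ob C' n) (boundaries C' n) (f n)"


section \<open>Spectral homology of a filtered complex\<close>

definition filt_down :: "('k, 'v, 'm) filtered_complex_scheme \<Rightarrow> real set \<Rightarrow> nat \<Rightarrow> 'v set" where
  "filt_down C L n = (if L = {} then {\<zero>\<^bsub>ob C n\<^esub>} else (\<Union>s\<in>L. filt C s n))"

definition interval_map ::
  "('k, 'w, 'm) filtered_complex_scheme \<Rightarrow> real set \<Rightarrow> (nat \<Rightarrow> 'v \<Rightarrow> 'w) \<Rightarrow> nat \<Rightarrow> 'v set \<Rightarrow> 'w set"
  where "interval_map C' I f n = quot_map (ob C' n) (filt_down C' (interval_L I) n) (f n)"

definition interval_complex ::
  "('k, 'v, 'm) filtered_complex_scheme \<Rightarrow> real set \<Rightarrow> ('k, 'v set) chain_complex" where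
  "interval_complex C I =
     \<lparr>ob = (\<lambda>n. quot_module (ob C n\<lparr>carrier := filt_down C (interval_R I) n\<rparr>)
                            (filt_down C (interval_L I) n)),
      bd = (\<lambda>n. quot_map (ob C (n - 1)) (filt_down C (interval_L I) (n - 1)) (bd C n))\<rparr>"

text \<open>The map \<open>H\<^sub>n(C\<^sub>I) \<rightarrow> H\<^sub>n(C'\<^sub>J)\<close> induced by a filtration-preserving chain map \<open>f : C \<rightarrow> C'\<close>,
  where \<open>R\<^sub>I \<subseteq> R\<^sub>J\<close> and \<open>L\<^sub>I \<subseteq> L\<^sub>J\<close>. The interval \<open>I\<close> is not a parameter: a class
  is sent to the union of the classes of the images of its representatives, whatever \<open>I\<close> is.\<close>

definition interval_homology_map ::
  "('k, 'w, 'm) filtered_complex_scheme \<Rightarrow> real set \<Rightarrow> nat \<Rightarrow> (nat \<Rightarrow> 'v \<Rightarrow> 'w)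
     \<Rightarrow> 'v set set \<Rightarrow> 'w set set" where
  "interval_homology_map C' J n f = homology_map (interval_complex C' J) n (interval_map C' J f)"

definition SZ ::
  "('k, 'v, 'm) filtered_complex_scheme \<Rightarrow> real \<Rightarrow> nat \<Rightarrow> real set \<Rightarrow> 'v set set set" where
  "SZ C r n I =
     interval_homology_map C I n (\<lambda>n x. x)
       ` carrier (homology (interval_complex C (interval_minus I r)) n)"

definition SB ::
  "('k, 'v, 'm) filtered_complex_scheme \<Rightarrow> real \<Rightarrow> nat \<Rightarrow> real set \<Rightarrow> 'v set set set" where
  "SB C r n I =
     a_kernel (homology (interval_complex C I) n)
              (homology (interval_complex C (interval_plus I r)) n)
              (interval_homology_map C (interval_plus I r) n (\<lambda>n x. x))"

definition SH ::
  "('k, 'v, 'm) filtered_complex_scheme \<Rightarrow> real \<Rightarrow> nat \<Rightarrow> real set \<Rightarrow> ('k, 'v set set set) module"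
  where "SH C r n I =
     quot_module (homology (interval_complex C I) n\<lparr>carrier := SZ C r n I\<rparr>) (SB C r n I)"

definition SH_map ::
  "('k, 'v, 'm) filtered_complex_scheme \<Rightarrow> ('k, 'w, 'l) filtered_complex_scheme
     \<Rightarrow> real \<Rightarrow> nat \<Rightarrow> real set \<Rightarrow> (nat \<Rightarrow> 'v \<Rightarrow> 'w) \<Rightarrow> 'v set set set \<Rightarrow> 'w set set set" where
  "SH_map C C' r n I f =
     restrict (quot_map (homology (interval_complex C' I) n) (SB C' r n I)
                 (interval_homology_map C' I n f))
       (carrier (SH C r n I))"


section \<open>Free modules\<close>

definition free_module :: "('k, 'm) ring_scheme \<Rightarrow> 'b set \<Rightarrow> ('k, 'b \<Rightarrow> 'k) module" where
  "free_module K B =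
     \<lparr>carrier = {c. (\<forall>b. c b \<in> carrier K) \<and> finite {b. c b \<noteq> \<zero>\<^bsub>K\<^esub>} \<and> {b. c b \<noteq> \<zero>\<^bsub>K\<^esub>} \<subseteq> B},
      monoid.mult = undefined, one = undefined,
      zero = (\<lambda>b. \<zero>\<^bsub>K\<^esub>), add = (\<lambda>c c' b. c b \<oplus>\<^bsub>K\<^esub> c' b),
      smult = (\<lambda>a c b. a \<otimes>\<^bsub>K\<^esub> c b)\<rparr>"

definition basis_vec :: "('k, 'm) ring_scheme \<Rightarrow> 'b \<Rightarrow> 'b \<Rightarrow> 'k" where
  "basis_vec K b = (\<lambda>b'. if b' = b then \<one>\<^bsub>K\<^esub> else \<zero>\<^bsub>K\<^esub>)"

definition linear_ext ::
  "('k, 'm) ring_scheme \<Rightarrow> ('k, 'v, 'l) module_scheme \<Rightarrow> ('b \<Rightarrow> 'v) \<Rightarrow> ('b \<Rightarrow> 'k) \<Rightarrow> 'v" where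
  "linear_ext K M f c = (\<Oplus>\<^bsub>M\<^esub>b\<in>{b. c b \<noteq> \<zero>\<^bsub>K\<^esub>}. c b \<odot>\<^bsub>M\<^esub> f b)"


section \<open>The complex of a quasimetric space\<close>

definition tuples :: "'a set \<Rightarrow> ('a \<Rightarrow> 'a \<Rightarrow> ennreal) \<Rightarrow> nat \<Rightarrow> 'a list set" where
  "tuples X d n =
     {xs. length xs = Suc n \<and> set xs \<subseteq> X \<and>
          (\<forall>i<n. xs ! i \<noteq> xs ! Suc i \<and> d (xs ! i) (xs ! Suc i) < \<infinity>)}"

definition tuple_length :: "('a \<Rightarrow> 'a \<Rightarrow> ennreal) \<Rightarrow> 'a list \<Rightarrow> ennreal" where
  "tuple_length d xs = (\<Sum>i<length xs - 1. d (xs ! i) (xs ! Suc i))"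

text \<open>A tuple viewed as a chain: tuples with a consecutive repetition are set equal to \<open>0\<close>.\<close>

definition tuple_chain :: "('k, 'm) ring_scheme \<Rightarrow> 'a list \<Rightarrow> 'a list \<Rightarrow> 'k" where
  "tuple_chain K xs = (if distinct_adj xs then basis_vec K xs else (\<lambda>ys. \<zero>\<^bsub>K\<^esub>))"

definition delete_nth :: "nat \<Rightarrow> 'a list \<Rightarrow> 'a list" where
  "delete_nth i xs = take i xs @ drop (Suc i) xs"

definition RC_mod ::
  "('k, 'm) ring_scheme \<Rightarrow> 'a set \<Rightarrow> ('a \<Rightarrow> 'a \<Rightarrow> ennreal) \<Rightarrow> nat \<Rightarrow> ('k, 'a list \<Rightarrow> 'k) module" where
  "RC_mod K X d n = free_module K (tuples X d n)"

definition RC_bd ::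
  "('k, 'm) ring_scheme \<Rightarrow> 'a set \<Rightarrow> ('a \<Rightarrow> 'a \<Rightarrow> ennreal) \<Rightarrow> nat
     \<Rightarrow> ('a list \<Rightarrow> 'k) \<Rightarrow> 'a list \<Rightarrow> 'k" where
  "RC_bd K X d n =
     (if n = 0 then (\<lambda>c. \<zero>\<^bsub>RC_mod K X d 0\<^esub>)
      else linear_ext K (RC_mod K X d (n - 1))
        (\<lambda>xs. \<Oplus>\<^bsub>RC_mod K X d (n - 1)\<^esub>i\<in>{0..n}.
           ((\<ominus>\<^bsub>K\<^esub> \<one>\<^bsub>K\<^esub>) [^]\<^bsub>K\<^esub> i) \<odot>\<^bsub>RC_mod K X d (n - 1)\<^esub> tuple_chain K (delete_nth i xs)))"

text \<open>Lengths are compared in \<^typ>\<open>ereal\<close>, because \<^const>\<open>ennreal\<close> sends negative \<open>s\<close> to \<open>0\<close>.\<close>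

definition RC ::
  "('k, 'm) ring_scheme \<Rightarrow> 'a set \<Rightarrow> ('a \<Rightarrow> 'a \<Rightarrow> ennreal)
     \<Rightarrow> ('k, 'a list \<Rightarrow> 'k) filtered_complex" where
  "RC K X d =
     \<lparr>ob = RC_mod K X d, bd = RC_bd K X d,
      filt = (\<lambda>s n. carrier (free_module K
                {xs \<in> tuples X d n. enn2ereal (tuple_length d xs) \<le> ereal s}))\<rparr>"

definition RC_map ::
  "('k, 'm) ring_scheme \<Rightarrow> 'b set \<Rightarrow> ('b \<Rightarrow> 'b \<Rightarrow> ennreal) \<Rightarrow> ('a \<Rightarrow> 'b) \<Rightarrow> nat
     \<Rightarrow> ('a list \<Rightarrow> 'k) \<Rightarrow> 'b list \<Rightarrow> 'k" where
  "RC_map K Y dY \<phi> n = linear_ext K (RC_mod K Y dY n) (\<lambda>xs. tuple_chain K (map \<phi> xs))"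

text \<open>The map \<open>SH\<^sup>r\<^sub>n\<^sub>,\<^sub>I(\<phi>)\<close>, as an extensional function on the carrier of
  \<^term>\<open>SH (RC K X dX) r n I\<close>.\<close>

definition qm_SH_map ::
  "('k, 'm) ring_scheme \<Rightarrow> 'a set \<Rightarrow> ('a \<Rightarrow> 'a \<Rightarrow> ennreal) \<Rightarrow> 'b set \<Rightarrow> ('b \<Rightarrow> 'b \<Rightarrow> ennreal)
     \<Rightarrow> real \<Rightarrow> nat \<Rightarrow> real set \<Rightarrow> ('a \<Rightarrow> 'b)
     \<Rightarrow> ('a list \<Rightarrow> 'k) set set set \<Rightarrow> ('b list \<Rightarrow> 'k) set set set" where
  "qm_SH_map K X dX Y dY r n I \<phi> = SH_map (RC K X dX) (RC K Y dY) r n I (RC_map K Y dY \<phi>)"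

end

theory Submission
  imports Defs
begin

text \<open>
  Two short maps \<open>\<phi>\<close>, \<open>\<psi>\<close> at distance at most \<open>r\<close> are joined by the classical prism operator
  \[ P (x_0, \dots, x_n) =
     \sum_i (-1)^i (\phi x_0, \dots, \phi x_i, \psi x_i, \dots, \psi x_n), \]
  which satisfies \<open>\<partial> P + P \<partial> = \<psi> - \<phi>\<close>. A prism tuple is a path that runs along the
  \<open>\<phi>\<close>-image, makes one jump of length at most \<open>r\<close>, and then runs along the \<open>\<psi>\<close>-image, so \<open>P\<close>
  raises the filtration by at most \<open>r\<close>.

  This is exactly what spectral homology forgives. A class in \<open>SZ\<close> is represented by a chain \<open>z\<close> in
  \<open>F\<^sub>R\<close> whose boundary lies in \<open>F\<^sub>L\<close> shifted down by \<open>r\<close>. Hence \<open>P (\<partial> z)\<close> lies in \<open>F\<^sub>L\<close> and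
  vanishes in the quotient, while \<open>P z\<close> lies in \<open>F\<^sub>R\<close> shifted up by \<open>r\<close>. So the images of \<open>z\<close>
  under \<open>\<psi>\<close> and \<open>\<phi>\<close> differ by something that becomes a boundary once \<open>I\<close> is enlarged to
  \<open>I\<^sup>+\<^sup>r\<close>, that is, by a class in \<open>SB\<close>. This is \<open>SH_map_eq_of_homotopy\<close>, a statement
  about filtered complexes in general. Finally, \<open>r\<close>-homotopy is the equivalence relation generated
  by pairs at distance at most \<open>r\<close>, and inducing equal maps is an equivalence relation.

  The combinatorial work is done on the dual side. Instead of chains, the lemmas treat functionals:
  a finite list of signed tuples acts on a function \<open>u\<close> of tuples by \<open>signed_eval\<close>, and the
  identities \<open>\<partial> \<partial> = 0\<close> and \<open>\<partial> P + P \<partial> = \<psi> - \<phi>\<close> become statements about all \<open>u\<close>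
  that follow by induction on the tuple (\<open>faces_faces\<close>, \<open>faces_prism\<close>). They hold for arbitrary
  lists, including degenerate and empty ones; passing to the normalized complex means restricting to
  functions that vanish on degenerate tuples, and \<open>faces_degenerate\<close> and \<open>prism_degenerate\<close> say
  that this class of functions is preserved. Lemma \<open>pairing_tuple_map\<close> transports the identities
  back to chains.
\<close>

section \<open>Subquotients of abelian groups\<close>

lemma a_r_coset_restrict [simp]: "N +>\<^bsub>M\<lparr>carrier := S\<rparr>\<^esub> x = N +>\<^bsub>M\<^esub> x"
  by (simp add: a_r_coset_def r_coset_def)

lemma additive_homI:
  assumes "abelian_group M" "abelian_group M'"
    and "\<And>x. x \<in> carrier M \<Longrightarrow> f x \<in> carrier M'"
    and "\<And>x y. x \<in> carrier M \<Longrightarrow> y \<in> carrier M \<Longrightarrow> f (x \<oplus>\<^bsub>M\<^esub> y) = f x \<oplus>\<^bsub>M'\<^esub> f y"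
  shows "abelian_group_hom M M' f"
  using assms
  by (intro abelian_group_homI group_hom.intro group_hom_axioms.intro abelian_group.a_group)
    (auto simp: hom_def)

lemma abelian_group_restrict:
  assumes "abelian_group M" "additive_subgroup S M"
  shows "abelian_group (M\<lparr>carrier := S\<rparr>)"
proof -
  interpret abelian_group M by fact
  interpret S: additive_subgroup S M by fact
  show ?thesis
  proof (rule abelian_groupI; simp)
    fix x assume "x \<in> S"
    then show "\<exists>y\<in>S. y \<oplus>\<^bsub>M\<^esub> x = \<zero>\<^bsub>M\<^esub>"
      by (intro bexI[of _ "\<ominus>\<^bsub>M\<^esub> x"]) (auto simp: l_neg)
  qed (auto simp: a_ac)
qed

lemma additive_hom_cong:
  assumes "abelian_group_hom M M' f" "\<And>x. x \<in> carrier M \<Longrightarrow> g x = f x"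
  shows "abelian_group_hom M M' g"
proof -
  interpret abelian_group_hom M M' f by fact
  show ?thesis
    by (rule additive_homI[OF G.abelian_group_axioms H.abelian_group_axioms])
      (auto simp: assms(2))
qed

text \<open>
  Homology, the interval quotients and spectral homology are all of the form \<open>S / N\<close> with
  \<open>N \<subseteq> S\<close> subgroups of an ambient group \<open>M\<close>. Cosets are formed in \<open>M\<close>, so one set of lemmas
  serves all three levels of nesting.
\<close>
locale subquotient =
  fixes M :: "('k, 'v, 'm) module_scheme" and S N :: "'v set"
  assumes ambient: "abelian_group M"
    and numerator: "additive_subgroup S M"
    and denominator: "additive_subgroup N M"
    and denominator_le: "N \<subseteq> S"
begin

sublocale G: abelian_group M by (rule ambient)
sublocale S: additive_subgroup S M by (rule numerator)
sublocale N: abelian_subgroup N M by (rule abelian_subgroupI3[OF denominator ambient])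

lemma coset_eq_iff:
  assumes "x \<in> carrier M" "y \<in> carrier M"
  shows "N +>\<^bsub>M\<^esub> x = N +>\<^bsub>M\<^esub> y \<longleftrightarrow> (\<exists>h\<in>N. x = h \<oplus>\<^bsub>M\<^esub> y)"
proof -
  have "N +>\<^bsub>M\<^esub> x = N +>\<^bsub>M\<^esub> y \<longleftrightarrow> x \<in> N +>\<^bsub>M\<^esub> y"
    using N.a_repr_independence' N.a_repr_independenceD assms by metis
  then show ?thesis by (auto simp: a_r_coset_def')
qed

lemma coset_eq_denominator_iff:
  assumes "x \<in> carrier M"
  shows "N +>\<^bsub>M\<^esub> x = N \<longleftrightarrow> x \<in> N"
  using assms by (metis N.a_rcos_const N.a_rcos_self)

lemma abelian_group_quot: "abelian_group (quot_module (M\<lparr>carrier := S\<rparr>) N)"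
proof -
  let ?M = "M\<lparr>carrier := S\<rparr>" and ?Q = "quot_module (M\<lparr>carrier := S\<rparr>) N"
  have M: "abelian_group ?M" by (rule abelian_group_restrict[OF ambient numerator])
  have "additive_subgroup N ?M"
  proof (rule additive_subgroupI, rule group.subgroupI)
    show "group (add_monoid ?M)" using M by (rule abelian_group.a_group)
    show "N \<subseteq> carrier (add_monoid ?M)" using denominator_le by simp
    show "N \<noteq> {}" using N.zero_closed by blast
    fix a assume a: "a \<in> N"
    have "\<ominus>\<^bsub>?M\<^esub> a = \<ominus>\<^bsub>M\<^esub> a"
      using a denominator_le
      by (intro abelian_group.minus_equality[OF M]) (auto simp: G.l_neg)
    then show "inv\<^bsub>add_monoid ?M\<^esub> a \<in> N"
      using a N.a_inv_closed unfolding a_inv_def by metis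
  next
    fix a b assume "a \<in> N" "b \<in> N"
    then show "a \<otimes>\<^bsub>add_monoid ?M\<^esub> b \<in> N" by simp
  qed
  then have "abelian_subgroup N ?M" by (rule abelian_subgroupI3[OF _ M])
  then interpret Q: comm_group "?M A_Mod N" by (rule abelian_subgroup.a_factorgroup_is_comm_group)
  have simps: "carrier ?Q = carrier (?M A_Mod N)" "A \<oplus>\<^bsub>?Q\<^esub> B = A \<otimes>\<^bsub>?M A_Mod N\<^esub> B"
    "\<zero>\<^bsub>?Q\<^esub> = \<one>\<^bsub>?M A_Mod N\<^esub>" for A B
    by (simp_all add: quot_module_def A_FactGroup_def FactGroup_def A_RCOSETS_def set_add_def)
  show ?thesis
    by (rule abelian_groupI, unfold simps)
      (simp_all add: Q.m_ac del: add_A_FactGroup)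
qed

lemma carrier_quot: "carrier (quot_module (M\<lparr>carrier := S\<rparr>) N) = (\<lambda>x. N +>\<^bsub>M\<^esub> x) ` S"
  by (auto simp: quot_module_def A_RCOSETS_def')

lemma zero_quot: "\<zero>\<^bsub>quot_module (M\<lparr>carrier := S\<rparr>) N\<^esub> = N"
  by (simp add: quot_module_def)

lemma add_quot:
  assumes "x \<in> carrier M" "y \<in> carrier M"
  shows "(N +>\<^bsub>M\<^esub> x) \<oplus>\<^bsub>quot_module (M\<lparr>carrier := S\<rparr>) N\<^esub> (N +>\<^bsub>M\<^esub> y) = N +>\<^bsub>M\<^esub> (x \<oplus>\<^bsub>M\<^esub> y)"
proof -
  have "(N +>\<^bsub>M\<^esub> x) \<oplus>\<^bsub>quot_module (M\<lparr>carrier := S\<rparr>) N\<^esub> (N +>\<^bsub>M\<^esub> y)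
      = (N +>\<^bsub>M\<^esub> x) <+>\<^bsub>M\<^esub> (N +>\<^bsub>M\<^esub> y)"
    by (simp add: quot_module_def set_add_def set_mult_def)
  then show ?thesis using N.a_rcos_sum assms by simp
qed

end

text \<open>
  The union over all representatives that defines \<open>quot_map\<close> is a union of copies of one and the same
  coset, because \<open>f\<close> moves two representatives apart only by an element of \<open>N'\<close>.
\<close>
lemma quot_map_coset:
  assumes "abelian_group_hom M M' f"
    and N: "additive_subgroup N M" and N': "additive_subgroup N' M'" and fN: "f ` N \<subseteq> N'"
    and x: "x \<in> carrier M"
  shows "quot_map M' N' f (N +>\<^bsub>M\<^esub> x) = N' +>\<^bsub>M'\<^esub> f x"
proof -
  interpret f: abelian_group_hom M M' f by fact
  interpret N: additive_subgroup N M by fact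
  interpret N': abelian_subgroup N' M' by (rule abelian_subgroupI3[OF N' f.H.abelian_group_axioms])
  have "N' +>\<^bsub>M'\<^esub> f (h \<oplus>\<^bsub>M\<^esub> x) = N' +>\<^bsub>M'\<^esub> f x" if "h \<in> N" for h
  proof (rule N'.a_repr_independence'[symmetric])
    show "f (h \<oplus>\<^bsub>M\<^esub> x) \<in> N' +>\<^bsub>M'\<^esub> f x"
      using that fN x by (auto simp: a_r_coset_def')
  qed (use x in simp)
  moreover have "N \<noteq> {}" using N.zero_closed by blast
  ultimately show ?thesis
    by (auto simp: quot_map_def a_r_coset_def'[where G = M])
qed

lemma quot_map_hom:
  assumes "subquotient M S N" "subquotient M' S' N'"
    and f: "abelian_group_hom M M' f" and fS: "f ` S \<subseteq> S'" and fN: "f ` N \<subseteq> N'"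
  shows "abelian_group_hom (quot_module (M\<lparr>carrier := S\<rparr>) N) (quot_module (M'\<lparr>carrier := S'\<rparr>) N')
           (quot_map M' N' f)"
proof -
  interpret Q: subquotient M S N by fact
  interpret Q': subquotient M' S' N' by fact
  interpret f: abelian_group_hom M M' f by fact
  note qm = quot_map_coset[OF f Q.denominator Q'.denominator fN]
  show ?thesis
  proof (rule additive_homI[OF Q.abelian_group_quot Q'.abelian_group_quot])
    fix A B
    assume A: "A \<in> carrier (quot_module (M\<lparr>carrier := S\<rparr>) N)"
    then obtain x where x: "A = N +>\<^bsub>M\<^esub> x" "x \<in> S" by (auto simp: Q.carrier_quot)
    then show "quot_map M' N' f A \<in> carrier (quot_module (M'\<lparr>carrier := S'\<rparr>) N')"
      using fS by (auto simp: qm Q'.carrier_quot)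
    assume "B \<in> carrier (quot_module (M\<lparr>carrier := S\<rparr>) N)"
    then obtain y where y: "B = N +>\<^bsub>M\<^esub> y" "y \<in> S" by (auto simp: Q.carrier_quot)
    show "quot_map M' N' f (A \<oplus>\<^bsub>quot_module (M\<lparr>carrier := S\<rparr>) N\<^esub> B)
        = quot_map M' N' f A \<oplus>\<^bsub>quot_module (M'\<lparr>carrier := S'\<rparr>) N'\<^esub> quot_map M' N' f B"
      using x y by (simp add: Q.add_quot Q'.add_quot qm)
  qed
qed

section \<open>Chain complexes and the maps they induce on homology\<close>

locale valid_chain_complex =
  fixes C :: "('k, 'v, 'm) chain_complex_scheme"
  assumes bd_hom: "abelian_group_hom (ob C n) (ob C (n - 1)) (bd C n)"
    and bd_bd: "x \<in> carrier (ob C (Suc n)) \<Longrightarrow> bd C n (bd C (Suc n) x) = \<zero>\<^bsub>ob C (n - 1)\<^esub>"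
begin

lemma ob_abelian: "abelian_group (ob C n)"
  using bd_hom[of n] by (rule abelian_group_hom.axioms(1))

lemma bd_Suc_hom: "abelian_group_hom (ob C (Suc n)) (ob C n) (bd C (Suc n))"
  using bd_hom[of "Suc n"] by simp

lemma subquotient_homology: "subquotient (ob C n) (cycles C n) (boundaries C n)"
proof (rule subquotient.intro)
  interpret d: abelian_group_hom "ob C n" "ob C (n - 1)" "bd C n" by (rule bd_hom)
  interpret e: abelian_group_hom "ob C (Suc n)" "ob C n" "bd C (Suc n)" by (rule bd_Suc_hom)
  show "abelian_group (ob C n)" by (rule ob_abelian)
  show "additive_subgroup (cycles C n) (ob C n)"
    unfolding cycles_def by (rule d.additive_subgroup_a_kernel)
  show "additive_subgroup (boundaries C n) (ob C n)"
    unfolding boundaries_def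
    using group_hom.img_is_subgroup[OF e.a_group_hom] by (intro additive_subgroupI) simp
  show "boundaries C n \<subseteq> cycles C n"
    by (auto simp: boundaries_def cycles_def a_kernel_def' bd_bd)
qed

end

lemma (in valid_chain_complex) abelian_group_homology: "abelian_group (homology C n)"
  unfolding homology_def by (rule subquotient.abelian_group_quot[OF subquotient_homology])

locale chain_map =
  dom: valid_chain_complex C + cod: valid_chain_complex C'
  for C :: "('k, 'v, 'm) chain_complex_scheme" and C' :: "('k, 'w, 'l) chain_complex_scheme" +
  fixes f :: "nat \<Rightarrow> 'v \<Rightarrow> 'w"
  assumes hom: "abelian_group_hom (ob C n) (ob C' n) (f n)"
    and commutes: "x \<in> carrier (ob C n) \<Longrightarrow> bd C' n (f n x) = f (n - 1) (bd C n x)"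
begin

lemma maps_cycles: "f n ` cycles C n \<subseteq> cycles C' n"
proof -
  interpret f: abelian_group_hom "ob C n" "ob C' n" "f n" by (rule hom)
  interpret f': abelian_group_hom "ob C (n - 1)" "ob C' (n - 1)" "f (n - 1)" by (rule hom)
  show ?thesis using f'.hom_zero by (auto simp: cycles_def a_kernel_def' commutes)
qed

lemma maps_boundaries: "f n ` boundaries C n \<subseteq> boundaries C' n"
proof -
  interpret f: abelian_group_hom "ob C (Suc n)" "ob C' (Suc n)" "f (Suc n)" by (rule hom)
  show ?thesis using commutes[of _ "Suc n"] f.hom_closed
    by (auto simp: boundaries_def simp flip: commutes[of _ "Suc n", simplified])
qed

lemma homology_map_coset:
  "z \<in> carrier (ob C n) \<Longrightarrow>
    homology_map C' n f (boundaries C n +>\<^bsub>ob C n\<^esub> z) = boundaries C' n +>\<^bsub>ob C' n\<^esub> f n z"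
  unfolding homology_map_def
  by (rule quot_map_coset[OF hom _ _ maps_boundaries])
    (auto intro: subquotient.denominator dom.subquotient_homology cod.subquotient_homology)

lemma homology_map_hom: "abelian_group_hom (homology C n) (homology C' n) (homology_map C' n f)"
  unfolding homology_map_def homology_def
  by (rule quot_map_hom[OF dom.subquotient_homology cod.subquotient_homology hom
        maps_cycles maps_boundaries])

end

section \<open>The end points of shifted intervals\<close>

text \<open>
  Membership in \<open>I\<^sub>-\<^sub>r\<close> and in \<open>I\<^sup>+\<^sup>r\<close>, written with points of \<open>I\<close> only. The identities for the
  end sets below rest on these two forms and on the inclusion of \<open>I\<close> in both intervals.
\<close>
lemma mem_interval_minus_iff:
  "s \<in> interval_minus I r \<longleftrightarrow> (\<exists>i\<in>I. s \<le> i) \<and> (\<exists>i\<in>I. i \<le> s + r)"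
proof -
  have "s \<in> (\<lambda>s. s - r) ` interval_L I \<longleftrightarrow> s + r \<in> interval_L I"
    by (auto intro!: image_eqI[of _ _ "s + r"])
  then show ?thesis
    by (auto simp: interval_minus_def interval_R_def interval_L_def not_less)
qed

lemma mem_interval_plus_iff:
  "s \<in> interval_plus I r \<longleftrightarrow> (\<exists>i\<in>I. s \<le> i + r) \<and> (\<exists>i\<in>I. i \<le> s)"
proof -
  have "s \<in> (\<lambda>s. s + r) ` interval_R I \<longleftrightarrow> s - r \<in> interval_R I"
    by (auto intro!: image_eqI[of _ _ "s - r"])
  then show ?thesis
    by (auto simp: interval_plus_def interval_R_def interval_L_def not_less diff_le_eq)
qed

lemma interval_minus_ends:
  assumes "I \<noteq> {}" "0 \<le> r"
  shows "interval_minus I r \<noteq> {}"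
    and "interval_R (interval_minus I r) = interval_R I"
    and "interval_L (interval_minus I r) = (\<lambda>s. s - r) ` interval_L I"
proof -
  have le: "I \<subseteq> interval_minus I r"
  proof
    fix i assume "i \<in> I"
    then show "i \<in> interval_minus I r"
      using assms(2) by (auto simp: mem_interval_minus_iff intro!: bexI[of _ i])
  qed
  then show "interval_minus I r \<noteq> {}" using assms(1) by blast
  show "interval_R (interval_minus I r) = interval_R I"
    using le unfolding interval_R_def set_eq_iff mem_Collect_eq
    by (meson order_trans subsetD mem_interval_minus_iff)
  show "interval_L (interval_minus I r) = (\<lambda>s. s - r) ` interval_L I"
  proof (intro equalityI subsetI)
    fix s assume s: "s \<in> interval_L (interval_minus I r)"
    have "s + r < i" if "i \<in> I" for i
    proof (rule ccontr)
      assume "\<not> s + r < i"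
      moreover have "s < i" using s le that by (auto simp: interval_L_def)
      ultimately have "s \<in> interval_minus I r"
        unfolding mem_interval_minus_iff using that by (intro conjI bexI[of _ i]) auto
      then show False using s by (auto simp: interval_L_def)
    qed
    then show "s \<in> (\<lambda>s. s - r) ` interval_L I"
      by (intro image_eqI[of _ _ "s + r"]) (auto simp: interval_L_def)
  next
    fix s assume "s \<in> (\<lambda>s. s - r) ` interval_L I"
    then obtain t where t: "s = t - r" "\<And>i. i \<in> I \<Longrightarrow> t < i" by (auto simp: interval_L_def)
    have "s < j" if j: "j \<in> interval_minus I r" for j
    proof -
      obtain i where "i \<in> I" "i \<le> j + r" using j by (auto simp: mem_interval_minus_iff)
      then show ?thesis using t(2)[of i] t(1) by linarith
    qed
    then show "s \<in> interval_L (interval_minus I r)" by (simp add: interval_L_def)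
  qed
qed

lemma interval_plus_ends:
  assumes "I \<noteq> {}" "0 \<le> r"
  shows "interval_plus I r \<noteq> {}"
    and "interval_R (interval_plus I r) = (\<lambda>s. s + r) ` interval_R I"
    and "interval_L (interval_plus I r) = interval_L I"
proof -
  have le: "I \<subseteq> interval_plus I r"
  proof
    fix i assume "i \<in> I"
    then show "i \<in> interval_plus I r"
      using assms(2) by (auto simp: mem_interval_plus_iff intro!: bexI[of _ i])
  qed
  then show "interval_plus I r \<noteq> {}" using assms(1) by blast
  show "interval_L (interval_plus I r) = interval_L I"
    using le unfolding interval_L_def mem_interval_plus_iff set_eq_iff mem_Collect_eq
    by (meson less_le_trans mem_interval_plus_iff subsetD)
  show "interval_R (interval_plus I r) = (\<lambda>s. s + r) ` interval_R I"
  proof (intro equalityI subsetI)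
    fix s assume "s \<in> (\<lambda>s. s + r) ` interval_R I"
    then obtain i where i: "i \<in> I" "s \<le> i + r" by (auto simp: interval_R_def)
    then have "i + r \<in> interval_plus I r"
      unfolding mem_interval_plus_iff using assms(2) by (intro conjI bexI[of _ i]) auto
    then show "s \<in> interval_R (interval_plus I r)" using i by (auto simp: interval_R_def)
  next
    fix s assume "s \<in> interval_R (interval_plus I r)"
    then obtain t i where "s \<le> t" "i \<in> I" "t \<le> i + r"
      by (auto simp: interval_R_def mem_interval_plus_iff)
    then have "s - r \<in> interval_R I" unfolding interval_R_def by (auto intro!: bexI[of _ i])
    then show "s \<in> (\<lambda>s. s + r) ` interval_R I"
      by (intro image_eqI[of _ _ "s - r"]) auto
  qed
qed

lemma interval_L_shift_subset:
  assumes "0 \<le> r"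
  shows "(\<lambda>s. s - r) ` interval_L I \<subseteq> interval_L I"
proof
  fix s assume "s \<in> (\<lambda>s. s - r) ` interval_L I"
  then obtain t where t: "s = t - r" "\<And>i. i \<in> I \<Longrightarrow> t < i" by (auto simp: interval_L_def)
  have "s < i" if "i \<in> I" for i
    using t(2)[OF that] t(1) assms by linarith
  then show "s \<in> interval_L I" by (simp add: interval_L_def)
qed

lemma interval_R_shift_supset:
  assumes "0 \<le> r"
  shows "interval_R I \<subseteq> (\<lambda>s. s + r) ` interval_R I"
proof
  fix s assume "s \<in> interval_R I"
  then obtain i where "i \<in> I" "s \<le> i" by (auto simp: interval_R_def)
  then have "s - r \<in> interval_R I"
    unfolding interval_R_def using assms by (auto intro!: bexI[of _ i])
  then show "s \<in> (\<lambda>s. s + r) ` interval_R I"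
    by (intro image_eqI[of _ _ "s - r"]) auto
qed

lemma interval_L_subset_R: "I \<noteq> {} \<Longrightarrow> interval_L I \<subseteq> interval_R I"
  by (force simp: interval_L_def interval_R_def)

section \<open>Homology of the interval quotients of a filtered complex\<close>

text \<open>
  The filtration is indexed by a linear order, so the unions \<open>filt_down C L n\<close>, inside which every
  construction below takes place, are subgroups.
\<close>
locale valid_filtered_complex = valid_chain_complex C for C :: "('k, 'v, 'm) filtered_complex_scheme" +
  assumes filt_subgroup: "additive_subgroup (filt C s n) (ob C n)"
    and filt_mono: "s \<le> t \<Longrightarrow> filt C s n \<subseteq> filt C t n"
    and bd_filt: "bd C n ` filt C s n \<subseteq> filt C s (n - 1)"
begin

lemma zero_filt: "\<zero>\<^bsub>ob C n\<^esub> \<in> filt C s n"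
  using additive_subgroup.zero_closed[OF filt_subgroup] .

lemma filt_down_subgroup: "additive_subgroup (filt_down C L n) (ob C n)"
proof -
  interpret abelian_group "ob C n" by (rule ob_abelian)
  interpret F: additive_subgroup "filt C s n" "ob C n" for s by (rule filt_subgroup)
  have closed: "x \<oplus>\<^bsub>ob C n\<^esub> y \<in> filt_down C L n"
    if x: "x \<in> filt_down C L n" and y: "y \<in> filt_down C L n" for x y
  proof (cases "L = {}")
    case False
    then obtain s t where "s \<in> L" "x \<in> filt C s n" "t \<in> L" "y \<in> filt C t n"
      using x y by (auto simp: filt_down_def)
    moreover from this have "x \<in> filt C (max s t) n" "y \<in> filt C (max s t) n"
      using filt_mono[of s "max s t" n] filt_mono[of t "max s t" n] by auto
    ultimately show ?thesis
      by (auto simp: filt_down_def max_def split: if_splits)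
  qed (use that in \<open>auto simp: filt_down_def\<close>)
  show ?thesis
  proof (rule additive_subgroupI, rule add.subgroupI)
    show "filt_down C L n \<subseteq> carrier (ob C n)"
      using F.a_subset by (auto simp: filt_down_def split: if_splits)
    have "\<zero>\<^bsub>ob C n\<^esub> \<in> filt_down C L n"
      using zero_filt by (auto simp: filt_down_def)
    then show "filt_down C L n \<noteq> {}" by blast
    show "\<ominus>\<^bsub>ob C n\<^esub> x \<in> filt_down C L n" if "x \<in> filt_down C L n" for x
      using that F.a_inv_closed by (auto simp: filt_down_def split: if_splits)
  qed (use closed in auto)
qed

lemma filt_down_subset: "L \<subseteq> L' \<Longrightarrow> filt_down C L n \<subseteq> filt_down C L' n"
  using zero_filt by (cases "L = {}"; cases "L' = {}") (auto simp: filt_down_def)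

lemma filt_down_carrier: "x \<in> filt_down C L n \<Longrightarrow> x \<in> carrier (ob C n)"
  using additive_subgroup.a_subset[OF filt_down_subgroup] by blast

end

text \<open>
  Used with shift \<open>0\<close> for the differential and for chain maps, and with shift \<open>r\<close> for the homotopy.
\<close>
lemma filt_down_shift:
  assumes "\<And>s. p ` filt C s n \<subseteq> filt C' (s + r) m"
    and "p \<zero>\<^bsub>ob C n\<^esub> = \<zero>\<^bsub>ob C' m\<^esub>"
  shows "p ` filt_down C L n \<subseteq> filt_down C' ((\<lambda>s. s + r) ` L) m"
  using assms by (cases "L = {}") (auto simp: filt_down_def image_subset_iff)

context valid_filtered_complex
begin

lemma bd_filt_down: "bd C n ` filt_down C L n \<subseteq> filt_down C L (n - 1)"
  using filt_down_shift[of "bd C n" C n C 0 "n - 1" L] bd_filt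
    abelian_group_hom.hom_zero[OF bd_hom] by simp

lemma subquotient_interval:
  "I \<noteq> {} \<Longrightarrow>
    subquotient (ob C n) (filt_down C (interval_R I) n) (filt_down C (interval_L I) n)"
  by (intro subquotient.intro ob_abelian filt_down_subgroup filt_down_subset interval_L_subset_R)

lemma bd_interval_complex:
  "z \<in> carrier (ob C n) \<Longrightarrow>
    bd (interval_complex C I) n (filt_down C (interval_L I) n +>\<^bsub>ob C n\<^esub> z) =
      filt_down C (interval_L I) (n - 1) +>\<^bsub>ob C (n - 1)\<^esub> bd C n z"
  unfolding interval_complex_def
  by (simp del: One_nat_def add: quot_map_coset[OF bd_hom filt_down_subgroup filt_down_subgroup bd_filt_down])

lemma ob_interval_complex:
  "ob (interval_complex C I) n =
    quot_module (ob C n\<lparr>carrier := filt_down C (interval_R I) n\<rparr>) (filt_down C (interval_L I) n)"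
  by (simp add: interval_complex_def)

lemma valid_chain_complex_interval:
  assumes "I \<noteq> {}"
  shows "valid_chain_complex (interval_complex C I)"
proof (rule valid_chain_complex.intro)
  note sq = subquotient_interval[OF assms]
  show "abelian_group_hom (ob (interval_complex C I) n) (ob (interval_complex C I) (n - 1))
      (bd (interval_complex C I) n)" for n
    unfolding interval_complex_def
    by (simp del: One_nat_def add: quot_map_hom[OF sq sq bd_hom bd_filt_down bd_filt_down])
  fix A n
  assume "A \<in> carrier (ob (interval_complex C I) (Suc n))"
  then obtain z where A: "A = filt_down C (interval_L I) (Suc n) +>\<^bsub>ob C (Suc n)\<^esub> z"
    and z: "z \<in> filt_down C (interval_R I) (Suc n)"
    unfolding ob_interval_complex subquotient.carrier_quot[OF sq] by blast
  have zc: "z \<in> carrier (ob C (Suc n))" by (rule filt_down_carrier[OF z])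
  interpret d: abelian_group_hom "ob C (Suc n)" "ob C n" "bd C (Suc n)" by (rule bd_Suc_hom)
  interpret L: abelian_subgroup "filt_down C (interval_L I) (n - 1)" "ob C (n - 1)"
    by (rule abelian_subgroupI3[OF filt_down_subgroup ob_abelian])
  have "bd (interval_complex C I) n (bd (interval_complex C I) (Suc n) A) =
      filt_down C (interval_L I) (n - 1) +>\<^bsub>ob C (n - 1)\<^esub> \<zero>\<^bsub>ob C (n - 1)\<^esub>"
    using bd_interval_complex[OF zc] bd_interval_complex[OF d.hom_closed[OF zc]]
    by (simp add: A bd_bd[OF zc])
  then show "bd (interval_complex C I) n (bd (interval_complex C I) (Suc n) A) =
      \<zero>\<^bsub>ob (interval_complex C I) (n - 1)\<^esub>"
    by (simp del: One_nat_def add: ob_interval_complex subquotient.zero_quot[OF sq] L.a_rcos_const)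
qed

end

text \<open>
  The element of \<open>H\<^sub>n(C\<^sub>I)\<close> represented by a chain \<open>z\<close> of the filtered complex itself. All statements
  about the nested quotients are reduced to such representatives.
\<close>
definition interval_class ::
  "('k, 'v, 'm) filtered_complex_scheme \<Rightarrow> real set \<Rightarrow> nat \<Rightarrow> 'v \<Rightarrow> 'v set set" where
  "interval_class C I n z =
     boundaries (interval_complex C I) n
       +>\<^bsub>ob (interval_complex C I) n\<^esub> (filt_down C (interval_L I) n +>\<^bsub>ob C n\<^esub> z)"

context valid_filtered_complex
begin

lemma cycles_interval:
  assumes "I \<noteq> {}"
  shows "cycles (interval_complex C I) n =
    (\<lambda>z. filt_down C (interval_L I) n +>\<^bsub>ob C n\<^esub> z) `
      {z \<in> filt_down C (interval_R I) n. bd C n z \<in> filt_down C (interval_L I) (n - 1)}"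
proof -
  note sq = subquotient_interval[OF assms]
  interpret d: abelian_group_hom "ob C n" "ob C (n - 1)" "bd C n" by (rule bd_hom)
  have "bd (interval_complex C I) n (filt_down C (interval_L I) n +>\<^bsub>ob C n\<^esub> z) =
      \<zero>\<^bsub>ob (interval_complex C I) (n - 1)\<^esub> \<longleftrightarrow> bd C n z \<in> filt_down C (interval_L I) (n - 1)"
    if "z \<in> filt_down C (interval_R I) n" for z
    using filt_down_carrier[OF that]
    by (simp del: One_nat_def add: bd_interval_complex ob_interval_complex subquotient.zero_quot[OF sq]
        subquotient.coset_eq_denominator_iff[OF sq])
  then show ?thesis
    by (auto simp: cycles_def a_kernel_def' ob_interval_complex subquotient.carrier_quot[OF sq])
qed

lemma boundaries_interval:
  assumes "I \<noteq> {}"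
  shows "boundaries (interval_complex C I) n =
    (\<lambda>w. filt_down C (interval_L I) n +>\<^bsub>ob C n\<^esub> bd C (Suc n) w) `
      filt_down C (interval_R I) (Suc n)"
  unfolding boundaries_def ob_interval_complex
    subquotient.carrier_quot[OF subquotient_interval[OF assms]] image_image
  using bd_interval_complex[of _ "Suc n" I] filt_down_carrier by (auto intro!: image_cong)

lemma carrier_homology_interval:
  assumes "I \<noteq> {}"
  shows "carrier (homology (interval_complex C I) n) = interval_class C I n `
    {z \<in> filt_down C (interval_R I) n. bd C n z \<in> filt_down C (interval_L I) (n - 1)}"
  unfolding homology_def interval_class_def
    subquotient.carrier_quot[OF valid_chain_complex.subquotient_homology[OF valid_chain_complex_interval[OF assms]]]
  by (simp only: cycles_interval[OF assms] image_image)

lemma interval_coset_mem: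
  assumes "I \<noteq> {}" "z \<in> filt_down C (interval_R I) n"
  shows "filt_down C (interval_L I) n +>\<^bsub>ob C n\<^esub> z \<in> carrier (ob (interval_complex C I) n)"
  using assms(2) unfolding ob_interval_complex
    subquotient.carrier_quot[OF subquotient_interval[OF assms(1)]] by blast

lemma interval_class_add:
  assumes I: "I \<noteq> {}"
    and z: "z \<in> filt_down C (interval_R I) n" and y: "y \<in> filt_down C (interval_R I) n"
  shows "interval_class C I n z \<oplus>\<^bsub>homology (interval_complex C I) n\<^esub> interval_class C I n y =
    interval_class C I n (z \<oplus>\<^bsub>ob C n\<^esub> y)"
proof -
  have "interval_class C I n z \<oplus>\<^bsub>homology (interval_complex C I) n\<^esub> interval_class C I n y =
     boundaries (interval_complex C I) n
       +>\<^bsub>ob (interval_complex C I) n\<^esub> ((filt_down C (interval_L I) n +>\<^bsub>ob C n\<^esub> z)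
         \<oplus>\<^bsub>ob (interval_complex C I) n\<^esub> (filt_down C (interval_L I) n +>\<^bsub>ob C n\<^esub> y))"
    unfolding interval_class_def homology_def
    by (rule subquotient.add_quot[OF valid_chain_complex.subquotient_homology[OF valid_chain_complex_interval[OF I]]
          interval_coset_mem[OF I z] interval_coset_mem[OF I y]])
  then show ?thesis
    by (simp add: interval_class_def ob_interval_complex
        subquotient.add_quot[OF subquotient_interval[OF I]] filt_down_carrier[OF z]
        filt_down_carrier[OF y])
qed

text \<open>
  A relative boundary: \<open>z\<close> is trivial in \<open>H\<^sub>n(C\<^sub>I)\<close> if it bounds in \<open>F\<^sub>R\<close> up to a term that the
  quotient by \<open>F\<^sub>L\<close> kills.
\<close>
lemma interval_class_eq_zero_iff:
  assumes I: "I \<noteq> {}" and z: "z \<in> filt_down C (interval_R I) n"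
  shows "interval_class C I n z = \<zero>\<^bsub>homology (interval_complex C I) n\<^esub> \<longleftrightarrow>
    (\<exists>w \<in> filt_down C (interval_R I) (Suc n). \<exists>l \<in> filt_down C (interval_L I) n.
       z = l \<oplus>\<^bsub>ob C n\<^esub> bd C (Suc n) w)"
proof -
  note H = valid_chain_complex.subquotient_homology[OF valid_chain_complex_interval[OF I]]
  note sq = subquotient_interval[OF I]
  have "interval_class C I n z = \<zero>\<^bsub>homology (interval_complex C I) n\<^esub> \<longleftrightarrow>
      filt_down C (interval_L I) n +>\<^bsub>ob C n\<^esub> z \<in> boundaries (interval_complex C I) n"
    unfolding interval_class_def homology_def subquotient.zero_quot[OF H]
    by (rule subquotient.coset_eq_denominator_iff[OF H interval_coset_mem[OF I z]])
  also have "\<dots> \<longleftrightarrow> (\<exists>w \<in> filt_down C (interval_R I) (Suc n).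
      filt_down C (interval_L I) n +>\<^bsub>ob C n\<^esub> z =
      filt_down C (interval_L I) n +>\<^bsub>ob C n\<^esub> bd C (Suc n) w)"
    by (auto simp: boundaries_interval[OF I])
  also have "\<dots> \<longleftrightarrow> (\<exists>w \<in> filt_down C (interval_R I) (Suc n).
      \<exists>l \<in> filt_down C (interval_L I) n. z = l \<oplus>\<^bsub>ob C n\<^esub> bd C (Suc n) w)"
    using abelian_group_hom.hom_closed[OF bd_Suc_hom] filt_down_carrier z
    by (intro bex_cong subquotient.coset_eq_iff[OF sq]) auto
  finally show ?thesis .
qed

end

locale filtered_map =
  dom: valid_filtered_complex C + cod: valid_filtered_complex C' + chain_map C C' f
  for C :: "('k, 'v, 'm) filtered_complex_scheme"
    and C' :: "('k, 'w, 'l) filtered_complex_scheme" and f +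
  assumes maps_filt: "f n ` filt C s n \<subseteq> filt C' s n"
begin

lemma maps_filt_down:
  assumes "L \<subseteq> L'"
  shows "f n ` filt_down C L n \<subseteq> filt_down C' L' n"
proof -
  have "f n ` filt_down C L n \<subseteq> filt_down C' L n"
    using filt_down_shift[of "f n" C n C' 0 n L] maps_filt abelian_group_hom.hom_zero[OF hom]
    by simp
  then show ?thesis using cod.filt_down_subset[OF assms] by blast
qed

lemma interval_map_coset:
  assumes "interval_L I \<subseteq> interval_L J" and "z \<in> carrier (ob C n)"
  shows "interval_map C' J f n (filt_down C (interval_L I) n +>\<^bsub>ob C n\<^esub> z) =
    filt_down C' (interval_L J) n +>\<^bsub>ob C' n\<^esub> f n z"
  unfolding interval_map_def
  by (rule quot_map_coset[OF hom dom.filt_down_subgroup cod.filt_down_subgroup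
        maps_filt_down[OF assms(1)] assms(2)])

lemma chain_map_interval:
  assumes I: "I \<noteq> {}" and J: "J \<noteq> {}"
    and L: "interval_L I \<subseteq> interval_L J" and R: "interval_R I \<subseteq> interval_R J"
  shows "chain_map (interval_complex C I) (interval_complex C' J) (interval_map C' J f)"
proof (intro chain_map.intro chain_map_axioms.intro)
  show "valid_chain_complex (interval_complex C I)" by (rule dom.valid_chain_complex_interval[OF I])
  show "valid_chain_complex (interval_complex C' J)" by (rule cod.valid_chain_complex_interval[OF J])
  show "abelian_group_hom (ob (interval_complex C I) n) (ob (interval_complex C' J) n)
      (interval_map C' J f n)" for n
    unfolding dom.ob_interval_complex cod.ob_interval_complex interval_map_def
    by (rule quot_map_hom[OF dom.subquotient_interval[OF I] cod.subquotient_interval[OF J] hom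
          maps_filt_down[OF R] maps_filt_down[OF L]])
  fix A n
  assume "A \<in> carrier (ob (interval_complex C I) n)"
  then obtain z where A: "A = filt_down C (interval_L I) n +>\<^bsub>ob C n\<^esub> z"
    and z: "z \<in> filt_down C (interval_R I) n"
    unfolding dom.ob_interval_complex subquotient.carrier_quot[OF dom.subquotient_interval[OF I]]
    by blast
  have zc: "z \<in> carrier (ob C n)" by (rule dom.filt_down_carrier[OF z])
  have "bd C n z \<in> carrier (ob C (n - 1))" "f n z \<in> carrier (ob C' n)"
    using abelian_group_hom.hom_closed[OF dom.bd_hom zc] abelian_group_hom.hom_closed[OF hom zc] .
  then show "bd (interval_complex C' J) n (interval_map C' J f n A) =
      interval_map C' J f (n - 1) (bd (interval_complex C I) n A)"
    by (simp add: A zc interval_map_coset[OF L] dom.bd_interval_complex cod.bd_interval_complex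
        commutes)
qed

lemma interval_homology_map_hom:
  assumes "I \<noteq> {}" "J \<noteq> {}" "interval_L I \<subseteq> interval_L J" "interval_R I \<subseteq> interval_R J"
  shows "abelian_group_hom (homology (interval_complex C I) n) (homology (interval_complex C' J) n)
    (interval_homology_map C' J n f)"
  unfolding interval_homology_map_def
  by (rule chain_map.homology_map_hom[OF chain_map_interval[OF assms]])

lemma interval_homology_map_class:
  assumes "I \<noteq> {}" "J \<noteq> {}" "interval_L I \<subseteq> interval_L J" "interval_R I \<subseteq> interval_R J"
    and z: "z \<in> filt_down C (interval_R I) n"
  shows "interval_homology_map C' J n f (interval_class C I n z) = interval_class C' J n (f n z)"
  unfolding interval_homology_map_def interval_class_def
  using chain_map.homology_map_coset[OF chain_map_interval[OF assms(1-4)]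
      dom.interval_coset_mem[OF assms(1) z]]
    interval_map_coset[OF assms(3) dom.filt_down_carrier[OF z]] by simp

end

lemma (in valid_filtered_complex) filtered_map_id: "filtered_map C C (\<lambda>n x. x)"
proof -
  have "abelian_group_hom (ob C n) (ob C n) (\<lambda>x. x)" for n
    by (simp add: additive_homI[OF ob_abelian ob_abelian])
  then show ?thesis
    by (intro filtered_map.intro chain_map.intro chain_map_axioms.intro filtered_map_axioms.intro
        valid_chain_complex_axioms valid_filtered_complex_axioms) auto
qed

section \<open>Spectral homology and homotopies that raise the filtration\<close>

context valid_filtered_complex
begin

text \<open>
  Shrinking \<open>I\<close> to \<open>I\<^sub>-\<^sub>r\<close> keeps the upper end \<open>R\<^sub>I\<close> and lowers \<open>L\<^sub>I\<close> by \<open>r\<close>, so it only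
  strengthens the cycle condition.
\<close>
lemma SZ_eq:
  assumes "I \<noteq> {}" "0 \<le> r"
  shows "SZ C r n I = interval_class C I n `
    {z \<in> filt_down C (interval_R I) n. bd C n z \<in> filt_down C ((\<lambda>s. s - r) ` interval_L I) (n - 1)}"
proof -
  note minus = interval_minus_ends[OF assms]
  interpret id: filtered_map C C "\<lambda>n x. x" by (rule filtered_map_id)
  have "interval_homology_map C I n (\<lambda>n x. x) (interval_class C (interval_minus I r) n z)
      = interval_class C I n z" if "z \<in> filt_down C (interval_R I) n" for z
    by (rule id.interval_homology_map_class)
      (use that minus assms interval_L_shift_subset in auto)
  then show ?thesis
    unfolding SZ_def carrier_homology_interval[OF minus(1)] image_image minus
    by (intro image_cong) auto
qed

lemma plus_map_hom:
  assumes "I \<noteq> {}" "0 \<le> r"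
  shows "abelian_group_hom (homology (interval_complex C I) n)
    (homology (interval_complex C (interval_plus I r)) n)
    (interval_homology_map C (interval_plus I r) n (\<lambda>n x. x))"
  by (rule filtered_map.interval_homology_map_hom[OF filtered_map_id])
    (use assms interval_plus_ends interval_R_shift_supset in auto)

lemma minus_map_hom:
  assumes "I \<noteq> {}" "0 \<le> r"
  shows "abelian_group_hom (homology (interval_complex C (interval_minus I r)) n)
    (homology (interval_complex C I) n) (interval_homology_map C I n (\<lambda>n x. x))"
  by (rule filtered_map.interval_homology_map_hom[OF filtered_map_id])
    (use assms interval_minus_ends interval_L_shift_subset in auto)

text \<open>
  Enlarging \<open>I\<close> to \<open>I\<^sup>+\<^sup>r\<close> keeps \<open>L\<^sub>I\<close> and raises the upper end by \<open>r\<close>, so it only makes more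
  chains available as bounding chains.
\<close>
lemma interval_class_in_SB_iff:
  assumes "I \<noteq> {}" "0 \<le> r"
    and z: "z \<in> filt_down C (interval_R I) n" "bd C n z \<in> filt_down C (interval_L I) (n - 1)"
  shows "interval_class C I n z \<in> SB C r n I \<longleftrightarrow>
    (\<exists>w \<in> filt_down C ((\<lambda>s. s + r) ` interval_R I) (Suc n). \<exists>l \<in> filt_down C (interval_L I) n.
       z = l \<oplus>\<^bsub>ob C n\<^esub> bd C (Suc n) w)"
proof -
  note plus = interval_plus_ends[OF assms(1,2)]
  have R: "interval_R I \<subseteq> interval_R (interval_plus I r)"
    using interval_R_shift_supset[OF assms(2)] plus by simp
  have "interval_homology_map C (interval_plus I r) n (\<lambda>n x. x) (interval_class C I n z)
      = interval_class C (interval_plus I r) n z"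
    by (rule filtered_map.interval_homology_map_class[OF filtered_map_id])
      (use assms plus R in auto)
  moreover have "interval_class C I n z \<in> carrier (homology (interval_complex C I) n)"
    using z by (auto simp: carrier_homology_interval[OF assms(1)])
  moreover have "z \<in> filt_down C (interval_R (interval_plus I r)) n"
    using z(1) filt_down_subset[OF R] by blast
  note interval_class_eq_zero_iff[OF plus(1) this]
  ultimately show ?thesis
    unfolding SB_def a_kernel_def' by (simp add: plus(2,3))
qed

text \<open>
  If \<open>z = l + \<partial> w\<close> with \<open>l\<close> in \<open>F\<^sub>L\<close>, then \<open>z\<close> and \<open>\<partial> w\<close> have the same class, and \<open>\<partial> w\<close>
  is an honest cycle, which satisfies every relative cycle condition.
\<close>
lemma SB_subset_SZ:
  assumes I: "I \<noteq> {}" and r: "0 \<le> r"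
  shows "SB C r n I \<subseteq> SZ C r n I"
proof
  fix x assume x: "x \<in> SB C r n I"
  then have "x \<in> carrier (homology (interval_complex C I) n)" by (simp add: SB_def a_kernel_def')
  then obtain z where xz: "x = interval_class C I n z" and z: "z \<in> filt_down C (interval_R I) n"
      "bd C n z \<in> filt_down C (interval_L I) (n - 1)"
    by (auto simp: carrier_homology_interval[OF I])
  then obtain w l where w: "w \<in> filt_down C ((\<lambda>s. s + r) ` interval_R I) (Suc n)"
    and l: "l \<in> filt_down C (interval_L I) n" and zwl: "z = l \<oplus>\<^bsub>ob C n\<^esub> bd C (Suc n) w"
    using x interval_class_in_SB_iff[OF I r z] by blast
  interpret G: abelian_group "ob C n" by (rule ob_abelian)
  interpret H: abelian_group "homology (interval_complex C I) n"
    by (rule valid_chain_complex.abelian_group_homology[OF valid_chain_complex_interval[OF I]])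
  interpret R: additive_subgroup "filt_down C (interval_R I) n" "ob C n" by (rule filt_down_subgroup)
  interpret e: abelian_group_hom "ob C (Suc n)" "ob C n" "bd C (Suc n)" by (rule bd_Suc_hom)
  note wc = filt_down_carrier[OF w] and lc = filt_down_carrier[OF l]
  have lR: "l \<in> filt_down C (interval_R I) n"
    using l filt_down_subset[OF interval_L_subset_R[OF I]] by blast
  have "bd C (Suc n) w = \<ominus>\<^bsub>ob C n\<^esub> l \<oplus>\<^bsub>ob C n\<^esub> z"
    using wc lc by (simp add: zwl G.r_neg1)
  then have wR: "bd C (Suc n) w \<in> filt_down C (interval_R I) n"
    using R.a_closed[OF R.a_inv_closed[OF lR] z(1)] by simp
  have "l \<in> carrier (ob C n)" "bd C (Suc n) w \<in> carrier (ob C n)" using lc wc by auto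
  have zero: "interval_class C I n l = \<zero>\<^bsub>homology (interval_complex C I) n\<^esub>"
    unfolding interval_class_eq_zero_iff[OF I lR]
    using additive_subgroup.zero_closed[OF filt_down_subgroup] l lc
    by (intro bexI[of _ "\<zero>\<^bsub>ob C (Suc n)\<^esub>"] bexI[of _ l]) auto
  have bdw: "bd C n (bd C (Suc n) w) \<in> filt_down C L (n - 1)" for L
    using bd_bd[OF wc] additive_subgroup.zero_closed[OF filt_down_subgroup] by simp
  have "interval_class C I n (bd C (Suc n) w) \<in> carrier (homology (interval_complex C I) n)"
    using wR bdw by (auto simp: carrier_homology_interval[OF I])
  then have "x = interval_class C I n (bd C (Suc n) w)"
    using interval_class_add[OF I lR wR] zero H.l_zero by (simp add: xz zwl)
  then show "x \<in> SZ C r n I"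
    using wR bdw by (auto simp: SZ_eq[OF I r])
qed

lemma subquotient_SH:
  assumes "I \<noteq> {}" "0 \<le> r"
  shows "subquotient (homology (interval_complex C I) n) (SZ C r n I) (SB C r n I)"
proof (rule subquotient.intro)
  show "abelian_group (homology (interval_complex C I) n)"
    by (rule valid_chain_complex.abelian_group_homology[OF valid_chain_complex_interval[OF assms(1)]])
  interpret m: abelian_group_hom "homology (interval_complex C (interval_minus I r)) n"
    "homology (interval_complex C I) n" "interval_homology_map C I n (\<lambda>n x. x)"
    by (rule minus_map_hom[OF assms])
  show "additive_subgroup (SZ C r n I) (homology (interval_complex C I) n)"
    unfolding SZ_def using group_hom.img_is_subgroup[OF m.a_group_hom]
    by (intro additive_subgroupI) simp
  show "additive_subgroup (SB C r n I) (homology (interval_complex C I) n)"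
    unfolding SB_def by (rule abelian_group_hom.additive_subgroup_a_kernel[OF plus_map_hom[OF assms]])
  show "SB C r n I \<subseteq> SZ C r n I" by (rule SB_subset_SZ[OF assms])
qed

end

text \<open>
  The heart of the matter: a chain homotopy that raises the filtration by at most \<open>r\<close> is invisible to
  \<open>SH\<^sup>r\<close>. The case distinction on \<open>n\<close> is there because complexes start in degree \<open>0\<close>, where the
  summand \<open>P \<partial>\<close> is absent (and \<open>n - 1\<close> would be the wrong degree).
\<close>
lemma SH_map_eq_of_homotopy:
  fixes C :: "('k, 'v, 'm) filtered_complex_scheme"
    and C' :: "('k, 'w, 'l) filtered_complex_scheme"
  assumes f: "filtered_map C C' f" and g: "filtered_map C C' g" and r: "0 \<le> r" and I: "I \<noteq> {}"
    and P: "\<And>n. abelian_group_hom (ob C n) (ob C' (Suc n)) (P n)"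
    and P_filt: "\<And>n s. P n ` filt C s n \<subseteq> filt C' (s + r) (Suc n)"
    and homotopy: "\<And>n z. z \<in> carrier (ob C n) \<Longrightarrow> g n z = f n z \<oplus>\<^bsub>ob C' n\<^esub>
      ((if n = 0 then \<zero>\<^bsub>ob C' n\<^esub> else P (n - 1) (bd C n z)) \<oplus>\<^bsub>ob C' n\<^esub> bd C' (Suc n) (P n z))"
  shows "SH_map C C' r n I f = SH_map C C' r n I g"
proof -
  interpret f: filtered_map C C' f by fact
  interpret g: filtered_map C C' g by fact
  let ?H = "homology (interval_complex C I) n" and ?H' = "homology (interval_complex C' I) n"
  interpret SH: subquotient ?H "SZ C r n I" "SB C r n I" by (rule f.dom.subquotient_SH[OF I r])
  interpret SH': subquotient ?H' "SZ C' r n I" "SB C' r n I" by (rule f.cod.subquotient_SH[OF I r])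
  have P_down: "P m ` filt_down C L m \<subseteq> filt_down C' ((\<lambda>s. s + r) ` L) (Suc m)" for L m
    by (rule filt_down_shift[of "P m"]) (simp_all add: P_filt abelian_group_hom.hom_zero[OF P])
  have key: "SB C' r n I +>\<^bsub>?H'\<^esub> interval_homology_map C' I n f x =
      SB C' r n I +>\<^bsub>?H'\<^esub> interval_homology_map C' I n g x" if "x \<in> SZ C r n I" for x
  proof -
    obtain z where xz: "x = interval_class C I n z" and z: "z \<in> filt_down C (interval_R I) n"
      and dz: "bd C n z \<in> filt_down C ((\<lambda>s. s - r) ` interval_L I) (n - 1)"
      using \<open>x \<in> SZ C r n I\<close> by (auto simp: f.dom.SZ_eq[OF I r])
    have zc: "z \<in> carrier (ob C n)" by (rule f.dom.filt_down_carrier[OF z])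
    have dzL: "bd C n z \<in> filt_down C (interval_L I) (n - 1)"
      using dz f.dom.filt_down_subset[OF interval_L_shift_subset[OF r]] by blast
    have cycle: "h n z \<in> filt_down C' (interval_R I) n"
        "bd C' n (h n z) \<in> filt_down C' (interval_L I) (n - 1)" if "filtered_map C C' h" for h
    proof -
      interpret h: filtered_map C C' h by fact
      show "h n z \<in> filt_down C' (interval_R I) n"
        using h.maps_filt_down[of "interval_R I" "interval_R I" n] z by blast
      show "bd C' n (h n z) \<in> filt_down C' (interval_L I) (n - 1)"
        using h.maps_filt_down[of "interval_L I" "interval_L I" "n - 1"] dzL h.commutes[OF zc]
        by auto
    qed
    note cf = cycle[OF f] and cg = cycle[OF g]
    have img: "interval_homology_map C' I n h x = interval_class C' I n (h n z)"
      if "filtered_map C C' h" for h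
      unfolding xz by (rule filtered_map.interval_homology_map_class[OF that I I _ _ z]) auto
    \<comment> \<open>The difference of the two images is \<open>l\<close>, which lies in \<open>F\<^sub>L\<close> since \<open>\<partial> z\<close> lies \<open>r\<close> below \<open>L\<close>,
      plus the boundary of \<open>P z\<close>, which lies at most \<open>r\<close> above \<open>R\<close>.\<close>
    define l where "l = (if n = 0 then \<zero>\<^bsub>ob C' n\<^esub> else P (n - 1) (bd C n z))"
    define d where "d = l \<oplus>\<^bsub>ob C' n\<^esub> bd C' (Suc n) (P n z)"
    have l: "l \<in> filt_down C' (interval_L I) n"
    proof (cases n)
      case 0
      then show ?thesis
        using additive_subgroup.zero_closed[OF f.cod.filt_down_subgroup] by (simp add: l_def)
    next
      case (Suc m)
      then show ?thesis
        using P_down[of m "(\<lambda>s. s - r) ` interval_L I"] dz by (auto simp: l_def image_image)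
    qed
    have Pz: "P n z \<in> filt_down C' ((\<lambda>s. s + r) ` interval_R I) (Suc n)"
      using P_down[of n "interval_R I"] z by blast
    interpret G: abelian_group "ob C' n" by (rule f.cod.ob_abelian)
    interpret d: abelian_group_hom "ob C' n" "ob C' (n - 1)" "bd C' n" by (rule f.cod.bd_hom)
    interpret R: additive_subgroup "filt_down C' (interval_R I) n" "ob C' n"
      by (rule f.cod.filt_down_subgroup)
    interpret L: additive_subgroup "filt_down C' (interval_L I) (n - 1)" "ob C' (n - 1)"
      by (rule f.cod.filt_down_subgroup)
    have dc: "d \<in> carrier (ob C' n)" and fc: "f n z \<in> carrier (ob C' n)"
      using abelian_group_hom.hom_closed[OF f.cod.bd_Suc_hom f.cod.filt_down_carrier[OF Pz]]
        f.cod.filt_down_carrier[OF l] f.cod.filt_down_carrier[OF cf(1)]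
      by (auto simp: d_def)
    have gfd: "g n z = f n z \<oplus>\<^bsub>ob C' n\<^esub> d"
      using homotopy[OF zc] by (simp add: d_def l_def)
    then have "d = \<ominus>\<^bsub>ob C' n\<^esub> f n z \<oplus>\<^bsub>ob C' n\<^esub> g n z"
      using dc fc by (simp add: G.r_neg1)
    then have dR: "d \<in> filt_down C' (interval_R I) n"
      and dL: "bd C' n d \<in> filt_down C' (interval_L I) (n - 1)"
      using cf cg fc f.cod.filt_down_carrier[OF cg(1)] by (auto simp del: One_nat_def)
    have "interval_class C' I n d \<in> SB C' r n I"
      unfolding f.cod.interval_class_in_SB_iff[OF I r dR dL] using l Pz by (auto simp: d_def)
    moreover have "interval_class C' I n (g n z) =
        interval_class C' I n d \<oplus>\<^bsub>?H'\<^esub> interval_class C' I n (f n z)"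
      using f.cod.interval_class_add[OF I dR cf(1)] dc fc by (simp add: gfd G.a_comm)
    moreover have "interval_class C' I n (f n z) \<in> carrier ?H'"
        "interval_class C' I n (g n z) \<in> carrier ?H'"
      using cf cg by (auto simp: f.cod.carrier_homology_interval[OF I])
    ultimately show ?thesis
      unfolding img[OF f] img[OF g] using SH'.coset_eq_iff by metis
  qed
  \<comment> \<open>A coset consists of elements of \<open>SZ\<close>, and \<open>quot_map\<close> is a union over them.\<close>
  have "quot_map ?H' (SB C' r n I) (interval_homology_map C' I n f) A =
      quot_map ?H' (SB C' r n I) (interval_homology_map C' I n g) A"
    if A_in: "A \<in> carrier (SH C r n I)" for A
  proof -
    obtain a where A: "A = SB C r n I +>\<^bsub>?H\<^esub> a" and a: "a \<in> SZ C r n I"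
      using A_in unfolding SH_def SH.carrier_quot by blast
    have "A \<subseteq> SZ C r n I"
      using a SH.denominator_le by (auto simp: A a_r_coset_def')
    then show ?thesis
      unfolding quot_map_def using key by (intro SUP_cong) auto
  qed
  then show ?thesis
    unfolding SH_map_def by (intro restrict_ext)
qed

section \<open>Faces and prisms of tuples\<close>

text \<open>
  A formal sum of signed terms, applied to a function \<open>u\<close> by linear extension. Keeping signs in the list,
  rather than coefficients in the ring, lets the recursions below be independent of \<open>K\<close>.
\<close>
primrec signed_eval :: "('k, 'm) ring_scheme \<Rightarrow> (bool \<times> 'c) list \<Rightarrow> ('c \<Rightarrow> 'k) \<Rightarrow> 'k" where
  "signed_eval K [] u = \<zero>\<^bsub>K\<^esub>"
| "signed_eval K (p # L) u =
     (if fst p then u (snd p) else \<ominus>\<^bsub>K\<^esub> u (snd p)) \<oplus>\<^bsub>K\<^esub> signed_eval K L u"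

definition negated_image :: "('c \<Rightarrow> 'd) \<Rightarrow> (bool \<times> 'c) list \<Rightarrow> (bool \<times> 'd) list" where
  "negated_image h = map (\<lambda>(s, y). (\<not> s, h y))"

text \<open>
  The alternating sum of faces, recursively on the first vertex. This is the augmented boundary, in which
  a single vertex has the empty tuple as its face; this makes the recursion uniform. The empty tuple is
  discarded later, by evaluating only on functions that vanish on it.
\<close>
primrec faces :: "'a list \<Rightarrow> (bool \<times> 'a list) list" where
  "faces [] = []"
| "faces (x # xs) = (True, xs) # negated_image ((#) x) (faces xs)"

text \<open>
  Unrolled, the recursion gives the alternating sum of the tuples
  \<open>\<phi> x\<^sub>0, \<dots>, \<phi> x\<^sub>i, \<psi> x\<^sub>i, \<dots>, \<psi> x\<^sub>n\<close>, the classical prism operator.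
\<close>
primrec prism :: "('a \<Rightarrow> 'b) \<Rightarrow> ('a \<Rightarrow> 'b) \<Rightarrow> 'a list \<Rightarrow> (bool \<times> 'b list) list" where
  "prism \<phi> \<psi> [] = []"
| "prism \<phi> \<psi> (x # xs) =
     (True, \<phi> x # \<psi> x # map \<psi> xs) # negated_image ((#) (\<phi> x)) (prism \<phi> \<psi> xs)"

context cring
begin

lemma signed_eval_closed [simp]:
  "(\<And>y. u y \<in> carrier R) \<Longrightarrow> signed_eval R L u \<in> carrier R"
  by (induction L) auto

lemma signed_eval_cong:
  "(\<And>y. y \<in> snd ` set L \<Longrightarrow> u y = w y) \<Longrightarrow> signed_eval R L u = signed_eval R L w"
  by (induction L) auto

lemma signed_eval_zero:
  "(\<And>y. y \<in> snd ` set L \<Longrightarrow> u y = \<zero>) \<Longrightarrow> signed_eval R L u = \<zero>"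
  by (induction L) auto

lemma signed_eval_add:
  assumes "\<And>y. u y \<in> carrier R" "\<And>y. w y \<in> carrier R"
  shows "signed_eval R L (\<lambda>y. u y \<oplus> w y) = signed_eval R L u \<oplus> signed_eval R L w"
  by (induction L) (auto simp: assms minus_add a_ac)

lemma signed_eval_minus:
  assumes "\<And>y. u y \<in> carrier R"
  shows "signed_eval R L (\<lambda>y. \<ominus> u y) = \<ominus> signed_eval R L u"
  by (induction L) (auto simp: assms minus_add)

lemma signed_eval_diff:
  assumes "\<And>y. u y \<in> carrier R" "\<And>y. w y \<in> carrier R"
  shows "signed_eval R L (\<lambda>y. u y \<ominus> w y) = signed_eval R L u \<ominus> signed_eval R L w"
  by (simp add: a_minus_def signed_eval_add signed_eval_minus assms)

lemma signed_eval_scale: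
  assumes "\<And>y. u y \<in> carrier R" "a \<in> carrier R"
  shows "signed_eval R L (\<lambda>y. a \<otimes> u y) = a \<otimes> signed_eval R L u"
  by (induction L) (auto simp: assms r_distr r_minus)

lemma signed_eval_finsum:
  assumes "finite B" "\<And>b y. u b y \<in> carrier R"
  shows "signed_eval R L (\<lambda>y. \<Oplus>b\<in>B. u b y) = (\<Oplus>b\<in>B. signed_eval R L (u b))"
  using assms
proof (induction B)
  case empty
  then show ?case by (simp add: signed_eval_zero)
next
  case (insert b B)
  then show ?case by (simp add: signed_eval_add)
qed

lemma signed_eval_negated_image:
  assumes "\<And>y. u y \<in> carrier R"
  shows "signed_eval R (negated_image h L) u = \<ominus> signed_eval R L (\<lambda>y. u (h y))"
  by (induction L) (auto simp: negated_image_def assms minus_add)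

lemma signed_eval_faces_Cons:
  assumes "\<And>y. u y \<in> carrier R"
  shows "signed_eval R (faces (x # xs)) u = u xs \<ominus> signed_eval R (faces xs) (\<lambda>ys. u (x # ys))"
  by (simp add: signed_eval_negated_image assms a_minus_def)

lemma signed_eval_prism_Cons:
  assumes "\<And>y. u y \<in> carrier R"
  shows "signed_eval R (prism \<phi> \<psi> (x # xs)) u =
    u (\<phi> x # \<psi> x # map \<psi> xs) \<ominus> signed_eval R (prism \<phi> \<psi> xs) (\<lambda>ys. u (\<phi> x # ys))"
  by (simp add: signed_eval_negated_image assms a_minus_def)

lemmas signed_eval_Cons = signed_eval_faces_Cons signed_eval_prism_Cons

lemma faces_map:
  assumes "\<And>y. u y \<in> carrier R"
  shows "signed_eval R (faces (map \<phi> xs)) u = signed_eval R (faces xs) (\<lambda>ys. u (map \<phi> ys))"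
  using assms
  by (induction xs arbitrary: u) (simp_all del: faces.simps(2) add: signed_eval_faces_Cons)

lemma faces_faces:
  assumes "\<And>y. u y \<in> carrier R"
  shows "signed_eval R (faces xs) (\<lambda>ys. signed_eval R (faces ys) u) = \<zero>"
  using assms
proof (induction xs arbitrary: u)
  case (Cons x xs)
  note u = Cons.prems
  have "signed_eval R (faces xs) (\<lambda>ys. signed_eval R (faces (x # ys)) u)
      = signed_eval R (faces xs) u \<ominus> \<zero>"
    using Cons.IH[of "\<lambda>ys. u (x # ys)"] u
    by (simp del: faces.simps(2) add: signed_eval_faces_Cons signed_eval_diff)
  moreover have "signed_eval R (faces (x # xs)) (\<lambda>ys. signed_eval R (faces ys) u)
      = signed_eval R (faces xs) u \<ominus> signed_eval R (faces xs) (\<lambda>ys. signed_eval R (faces (x # ys)) u)"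
    by (rule signed_eval_faces_Cons) (simp add: u)
  ultimately show ?case using u by (simp add: minus_eq r_neg del: faces.simps(2))
qed simp

text \<open>
  The homotopy formula \<open>\<partial> P = \<psi> - \<phi> - P \<partial>\<close>. The prism over \<open>x # xs\<close> has one new term
  \<open>\<phi> x # \<psi> x # \<psi> xs\<close>. Its face without \<open>\<phi> x\<close> is the \<open>\<psi>\<close>-image, its face without \<open>\<psi> x\<close>
  cancels the \<open>\<psi>\<close>-side of the induction hypothesis with \<open>\<phi> x\<close> prepended, and its other faces
  belong to \<open>P \<partial>\<close>.
\<close>
lemma faces_prism:
  assumes "\<And>y. u y \<in> carrier R"
  shows "signed_eval R (prism \<phi> \<psi> xs) (\<lambda>ys. signed_eval R (faces ys) u)
    = u (map \<psi> xs) \<ominus> u (map \<phi> xs) \<ominus> signed_eval R (faces xs) (\<lambda>ys. signed_eval R (prism \<phi> \<psi> ys) u)"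
  using assms
proof (induction xs arbitrary: u)
  case Nil
  then show ?case by (simp add: minus_eq r_neg)
next
  case (Cons x xs)
  note u = Cons.prems
  let ?u = "\<lambda>ys. u (\<phi> x # ys)"
  define A B where "A = signed_eval R (prism \<phi> \<psi> xs) u"
    and "B = signed_eval R (faces xs) (\<lambda>ys. u (\<phi> x # \<psi> x # map \<psi> ys))"
  define D where "D = signed_eval R (faces xs) (\<lambda>ys. signed_eval R (prism \<phi> \<psi> ys) ?u)"
  have closed: "A \<in> carrier R" "B \<in> carrier R" "D \<in> carrier R" by (simp_all add: A_def B_def D_def u)
  have IH: "signed_eval R (prism \<phi> \<psi> xs) (\<lambda>ys. signed_eval R (faces ys) ?u)
      = u (\<phi> x # map \<psi> xs) \<ominus> u (\<phi> x # map \<phi> xs) \<ominus> D"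
    using Cons.IH[of ?u] u by (simp add: D_def)
  have "signed_eval R (prism \<phi> \<psi> (x # xs)) (\<lambda>ys. signed_eval R (faces ys) u)
      = u (\<psi> x # map \<psi> xs) \<ominus> (u (\<phi> x # map \<psi> xs) \<ominus> B)
        \<ominus> (A \<ominus> (u (\<phi> x # map \<psi> xs) \<ominus> u (\<phi> x # map \<phi> xs) \<ominus> D))"
    using u IH
    by (simp del: faces.simps(2) prism.simps(2)
        add: signed_eval_Cons signed_eval_diff A_def B_def faces_map)
  moreover have "signed_eval R (faces (x # xs)) (\<lambda>ys. signed_eval R (prism \<phi> \<psi> ys) u)
      = A \<ominus> (B \<ominus> D)"
    using u
    by (simp del: faces.simps(2) prism.simps(2) add: signed_eval_Cons signed_eval_diff A_def B_def D_def)
  moreover have "a \<ominus> (m \<ominus> B) \<ominus> (A \<ominus> (m \<ominus> f \<ominus> D)) = a \<ominus> f \<ominus> (A \<ominus> (B \<ominus> D))"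
    if "a \<in> carrier R" "m \<in> carrier R" "f \<in> carrier R" for a m f
  proof -
    have "a \<ominus> (m \<ominus> B) \<ominus> (A \<ominus> (m \<ominus> f \<ominus> D)) = (m \<oplus> \<ominus> m) \<oplus> (a \<ominus> f \<ominus> (A \<ominus> (B \<ominus> D)))"
      using closed that by (simp add: minus_eq minus_add a_ac)
    then show ?thesis using closed that by (simp add: r_neg)
  qed
  ultimately show ?case
    using u by (simp del: faces.simps(2) prism.simps(2))
qed

text \<open>
  In the boundary of a tuple with a repetition \<open>x\<^sub>i = x\<^sub>i\<^sub>+\<^sub>1\<close>, the faces that omit \<open>x\<^sub>i\<close> and \<open>x\<^sub>i\<^sub>+\<^sub>1\<close>
  are equal and have opposite signs, and all other faces are degenerate.
\<close>
lemma faces_degenerate: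
  assumes "\<And>y. u y \<in> carrier R" "\<And>y. \<not> distinct_adj y \<Longrightarrow> u y = \<zero>" "\<not> distinct_adj xs"
  shows "signed_eval R (faces xs) u = \<zero>"
  using assms
proof (induction xs arbitrary: u)
  case (Cons x xs)
  note u = Cons.prems(1,2)
  obtain y ys where xs: "xs = y # ys" using Cons.prems(3) by (cases xs) auto
  show ?case
  proof (cases "x = y")
    case True
    have "signed_eval R (faces ys) (\<lambda>zs. u (x # y # zs)) = \<zero>"
      by (rule signed_eval_zero) (simp add: u True)
    then show ?thesis
      using u by (simp del: faces.simps(2) add: xs signed_eval_faces_Cons True minus_eq r_neg)
  next
    case False
    then have deg: "\<not> distinct_adj xs" using Cons.prems(3) by (simp add: xs)
    have "\<not> distinct_adj (x # zs)" if "\<not> distinct_adj zs" for zs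
      using that by (cases zs) auto
    then have "signed_eval R (faces xs) (\<lambda>zs. u (x # zs)) = \<zero>"
      using Cons.IH[of "\<lambda>zs. u (x # zs)"] u deg by blast
    then show ?thesis
      using u deg by (simp del: faces.simps(2) add: signed_eval_faces_Cons minus_eq)
  qed
qed simp

end

lemma not_distinct_adj_Cons: "\<not> distinct_adj zs \<Longrightarrow> \<not> distinct_adj (z # zs)"
  by (cases zs) auto

text \<open>
  Here nothing has to cancel: the vertex at which a prism tuple jumps occurs in both its \<open>\<phi>\<close>-part and its
  \<open>\<psi>\<close>-part, so one of the two parts contains both members of any repetition.
\<close>
lemma prism_degenerate:
  assumes "\<not> distinct_adj xs" "(s, ys) \<in> set (prism \<phi> \<psi> xs)"
  shows "\<not> distinct_adj ys"
  using assms
proof (induction xs arbitrary: s ys)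
  case (Cons x xs)
  have deg: "\<not> distinct_adj (map \<psi> (x # xs))"
    using Cons.prems(1) distinct_adj_mapD[of \<psi> "x # xs"] by metis
  from Cons.prems(2) consider "ys = \<phi> x # map \<psi> (x # xs)"
    | t zs where "ys = \<phi> x # zs" "(t, zs) \<in> set (prism \<phi> \<psi> xs)"
    by (auto simp: negated_image_def)
  then show ?case
  proof cases
    case 1
    then show ?thesis using not_distinct_adj_Cons[OF deg] by metis
  next
    case 2
    show ?thesis
    proof (cases "distinct_adj xs")
      case False
      show ?thesis unfolding 2(1) by (rule not_distinct_adj_Cons[OF Cons.IH[OF False 2(2)]])
    next
      case True
      then obtain xs' where "xs = x # xs'" using Cons.prems(1) by (cases xs) auto
      then show ?thesis using 2 by (auto simp: negated_image_def)
    qed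
  qed
qed simp

section \<open>Faces and prisms stay in the quasimetric complex\<close>

lemma tuple_length_simps [simp]:
  "tuple_length d [] = 0" "tuple_length d [x] = 0"
  "tuple_length d (x # y # xs) = d x y + tuple_length d (y # xs)"
  by (simp_all add: tuple_length_def sum.lessThan_Suc_shift del: sum.lessThan_Suc)

lemma tuple_length_Cons_mono: "tuple_length d xs \<le> tuple_length d (x # xs)"
  by (cases xs) auto

text \<open>
  Finiteness of all steps is the same as finiteness of the total length. In this form membership of a face
  or of a prism tuple follows from the estimates of its length.
\<close>
lemma mem_tuples_iff:
  "xs \<in> tuples X d n \<longleftrightarrow>
    length xs = Suc n \<and> set xs \<subseteq> X \<and> distinct_adj xs \<and> tuple_length d xs < \<infinity>"
proof -
  have "(\<forall>i<n. xs ! i \<noteq> xs ! Suc i) \<longleftrightarrow> distinct_adj xs"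
    and "(\<forall>i<n. d (xs ! i) (xs ! Suc i) < \<infinity>) \<longleftrightarrow> tuple_length d xs < \<infinity>"
    if "length xs = Suc n"
    using that by (auto simp: distinct_adj_conv_nth tuple_length_def)
  then show ?thesis unfolding tuples_def by auto
qed

lemma faces_length: "y \<in> snd ` set (faces xs) \<Longrightarrow> length xs = Suc (length y)"
  by (induction xs arbitrary: y) (force simp: negated_image_def)+

lemma faces_set: "y \<in> snd ` set (faces xs) \<Longrightarrow> set y \<subseteq> set xs"
  by (induction xs arbitrary: y) (fastforce simp: negated_image_def)+

text \<open>
  Omitting an inner vertex is the triangle inequality; omitting an end vertex drops a summand.
\<close>
lemma (in quasimetric_space) faces_tuple_length:
  assumes "y \<in> snd ` set (faces xs)" "set xs \<subseteq> X"
  shows "tuple_length d y \<le> tuple_length d xs"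
  using assms
proof (induction xs arbitrary: y)
  case (Cons x xs)
  consider "y = xs" | zs where "y = x # zs" "zs \<in> snd ` set (faces xs)"
    using Cons.prems(1) by (force simp: negated_image_def)
  then show ?case
  proof cases
    case 1
    then show ?thesis by (simp add: tuple_length_Cons_mono)
  next
    case 2
    then obtain x' xs' where xs: "xs = x' # xs'" by (cases xs) auto
    consider "zs = xs'" | zs' where "zs = x' # zs'"
      using 2(2) by (force simp: negated_image_def xs)
    then show ?thesis
    proof cases
      case 1
      show ?thesis
      proof (cases xs')
        case (Cons x'' xs'')
        then have "d x x'' \<le> d x x' + d x' x''" using Cons.prems(2) by (auto simp: xs intro: triangle)
        then show ?thesis
          using 1 2(1) Cons by (simp add: xs add.assoc[symmetric] add_right_mono)
      qed (use 1 2(1) in simp)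
    next
      case zs': 2
      then show ?thesis
        using Cons.IH[OF 2(2)] Cons.prems(2) 2(1) by (simp add: xs add_left_mono)
    qed
  qed
qed simp

lemma short_map_tuple_length:
  assumes "\<phi> \<in> short_maps X dX Y dY" "set xs \<subseteq> X"
  shows "tuple_length dY (map \<phi> xs) \<le> tuple_length dX xs"
  using assms(2)
proof (induction xs rule: induct_list012)
  case (3 x x' xs)
  then show ?case using assms(1) by (auto simp: short_maps_def intro!: add_mono)
qed auto

lemma prism_length: "y \<in> snd ` set (prism \<phi> \<psi> xs) \<Longrightarrow> length y = Suc (length xs)"
  by (induction xs arbitrary: y) (force simp: negated_image_def)+

lemma prism_set: "y \<in> snd ` set (prism \<phi> \<psi> xs) \<Longrightarrow> set y \<subseteq> \<phi> ` set xs \<union> \<psi> ` set xs"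
  by (induction xs arbitrary: y) (fastforce simp: negated_image_def)+

text \<open>
  A prism tuple makes a single jump, of length at most \<open>\<epsilon>\<close>, and short maps do not lengthen the rest.
\<close>
lemma prism_tuple_length:
  assumes \<phi>: "\<phi> \<in> short_maps X dX Y dY" and \<psi>: "\<psi> \<in> short_maps X dX Y dY"
    and close: "\<And>x. x \<in> X \<Longrightarrow> dY (\<phi> x) (\<psi> x) \<le> \<epsilon>"
    and "y \<in> snd ` set (prism \<phi> \<psi> xs)" "set xs \<subseteq> X"
  shows "tuple_length dY y \<le> tuple_length dX xs + \<epsilon>"
  using assms(4,5)
proof (induction xs arbitrary: y)
  case (Cons x xs)
  consider "y = \<phi> x # \<psi> x # map \<psi> xs"
    | zs where "y = \<phi> x # zs" "zs \<in> snd ` set (prism \<phi> \<psi> xs)"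
    using Cons.prems(1) by (force simp: negated_image_def)
  then show ?case
  proof cases
    case 1
    have "tuple_length dY (map \<psi> (x # xs)) \<le> tuple_length dX (x # xs)"
      using Cons.prems(2) by (rule short_map_tuple_length[OF \<psi>])
    then have "dY (\<phi> x) (\<psi> x) + tuple_length dY (map \<psi> (x # xs)) \<le> \<epsilon> + tuple_length dX (x # xs)"
      using close Cons.prems(2) by (intro add_mono) auto
    then show ?thesis by (simp add: 1 add.commute)
  next
    case 2
    then obtain x' xs' where xs: "xs = x' # xs'" by (cases xs) auto
    obtain zs' where zs: "zs = \<phi> x' # zs'"
      using 2(2) by (force simp: negated_image_def xs)
    have "dY (\<phi> x) (\<phi> x') \<le> dX x x'"
      using \<phi> Cons.prems(2) by (auto simp: short_maps_def xs)
    moreover have "tuple_length dY zs \<le> tuple_length dX xs + \<epsilon>"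
      using Cons.IH[OF 2(2)] Cons.prems(2) by simp
    ultimately have "dY (\<phi> x) (\<phi> x') + tuple_length dY zs \<le> dX x x' + (tuple_length dX xs + \<epsilon>)"
      by (rule add_mono)
    then show ?thesis by (simp add: 2(1) zs xs add.assoc)
  qed
qed simp

lemma faces_tuples:
  assumes "quasimetric_space X d" "xs \<in> tuples X d n" "y \<in> snd ` set (faces xs)" "y \<noteq> []"
    "distinct_adj y"
  shows "y \<in> tuples X d (n - 1)"
proof -
  have "set y \<subseteq> X" using faces_set[OF assms(3)] assms(2) by (auto simp: mem_tuples_iff)
  moreover have "tuple_length d y \<le> tuple_length d xs"
    using quasimetric_space.faces_tuple_length[OF assms(1,3)] assms(2) by (simp add: mem_tuples_iff)
  then have "tuple_length d y < \<infinity>" using assms(2) le_less_trans by (auto simp: mem_tuples_iff)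
  moreover have "length y = Suc (n - 1)"
    using faces_length[OF assms(3)] assms(2,4) by (cases y) (auto simp: mem_tuples_iff)
  ultimately show ?thesis using assms(5) by (simp add: mem_tuples_iff)
qed

lemma map_tuples:
  assumes "\<phi> \<in> short_maps X dX Y dY" "xs \<in> tuples X dX n" "distinct_adj (map \<phi> xs)"
  shows "map \<phi> xs \<in> tuples Y dY n"
proof -
  have "set xs \<subseteq> X" using assms(2) by (simp add: mem_tuples_iff)
  moreover have "tuple_length dY (map \<phi> xs) < \<infinity>"
    using short_map_tuple_length[OF assms(1) \<open>set xs \<subseteq> X\<close>] assms(2) le_less_trans
    by (auto simp: mem_tuples_iff)
  ultimately show ?thesis
    using assms by (auto simp: mem_tuples_iff short_maps_def)
qed

lemma prism_tuples:
  assumes \<phi>: "\<phi> \<in> short_maps X dX Y dY" and \<psi>: "\<psi> \<in> short_maps X dX Y dY"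
    and close: "\<And>x. x \<in> X \<Longrightarrow> dY (\<phi> x) (\<psi> x) \<le> ennreal r"
    and xs: "xs \<in> tuples X dX n" and y: "y \<in> snd ` set (prism \<phi> \<psi> xs)" "distinct_adj y"
  shows "y \<in> tuples Y dY (Suc n)"
proof -
  have X: "set xs \<subseteq> X" using xs by (simp add: mem_tuples_iff)
  have "\<phi> ` set xs \<union> \<psi> ` set xs \<subseteq> Y" using \<phi> \<psi> X by (auto simp: short_maps_def)
  then have "set y \<subseteq> Y" using prism_set[OF y(1)] by (rule subset_trans[rotated])
  moreover have "tuple_length dY y \<le> tuple_length dX xs + ennreal r"
    by (rule prism_tuple_length[OF \<phi> \<psi> _ y(1) X]) (rule close)
  moreover have "tuple_length dX xs + ennreal r < \<infinity>" using xs by (simp add: mem_tuples_iff)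
  ultimately have "set y \<subseteq> Y" "tuple_length dY y < \<infinity>" by (blast intro: le_less_trans)+
  then show ?thesis
    using prism_length[OF y(1)] xs y(2) by (simp add: mem_tuples_iff)
qed

lemma enn2ereal_le_add:
  assumes "a \<le> b + ennreal r" "enn2ereal b \<le> ereal s" "0 \<le> r"
  shows "enn2ereal a \<le> ereal (s + r)"
proof -
  have "enn2ereal a \<le> enn2ereal b + ereal r"
    using assms(1,3) by (simp add: less_eq_ennreal.rep_eq plus_ennreal.rep_eq)
  also have "\<dots> \<le> ereal s + ereal r" using assms(2) by (rule add_right_mono)
  finally show ?thesis by simp
qed

section \<open>Free modules and maps given by signed tuples\<close>

text \<open>
  The coefficient of \<open>b\<close> in the chain of the tuple \<open>y\<close>, as a function of \<open>y\<close>. It vanishes on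
  degenerate tuples, as the normalized complex demands, and on the empty tuple, which cuts off the
  augmentation.
\<close>
definition normal_indicator :: "('k, 'm) ring_scheme \<Rightarrow> 'a list \<Rightarrow> 'a list \<Rightarrow> 'k" where
  "normal_indicator K b y = (if y = [] then \<zero>\<^bsub>K\<^esub> else tuple_chain K y b)"

text \<open>
  The linear functional on chains with values \<open>u\<close> on the basis.
\<close>
definition pairing :: "('k, 'm) ring_scheme \<Rightarrow> ('b \<Rightarrow> 'k) \<Rightarrow> ('b \<Rightarrow> 'k) \<Rightarrow> 'k" where
  "pairing K c u = (\<Oplus>\<^bsub>K\<^esub>a\<in>{a. c a \<noteq> \<zero>\<^bsub>K\<^esub>}. c a \<otimes>\<^bsub>K\<^esub> u a)"

text \<open>
  The linear map that sends a basis tuple \<open>a\<close> to the signed sum of tuples \<open>t a\<close> in the normalized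
  complex, given through its coordinates. The differential, the induced chain maps and the homotopy all
  have this form.
\<close>
definition tuple_map ::
  "('k, 'm) ring_scheme \<Rightarrow> ('a list \<Rightarrow> (bool \<times> 'b list) list) \<Rightarrow> ('a list \<Rightarrow> 'k) \<Rightarrow> 'b list \<Rightarrow> 'k"
  where "tuple_map K t c b = pairing K c (\<lambda>a. signed_eval K (t a) (normal_indicator K b))"

lemma free_module_simps [simp]:
  "\<zero>\<^bsub>free_module K B\<^esub> = (\<lambda>b. \<zero>\<^bsub>K\<^esub>)"
  "c \<oplus>\<^bsub>free_module K B\<^esub> c' = (\<lambda>b. c b \<oplus>\<^bsub>K\<^esub> c' b)"
  "a \<odot>\<^bsub>free_module K B\<^esub> c = (\<lambda>b. a \<otimes>\<^bsub>K\<^esub> c b)"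
  by (simp_all add: free_module_def)

lemma free_module_carrierD:
  assumes "c \<in> carrier (free_module K B)"
  shows "c b \<in> carrier K" "finite {b. c b \<noteq> \<zero>\<^bsub>K\<^esub>}" "b \<notin> B \<Longrightarrow> c b = \<zero>\<^bsub>K\<^esub>"
  using assms by (auto simp: free_module_def)

lemma free_module_carrierI:
  assumes "\<And>b. c b \<in> carrier K" "finite S" "\<And>b. b \<notin> S \<Longrightarrow> c b = \<zero>\<^bsub>K\<^esub>"
    "\<And>b. b \<notin> B \<Longrightarrow> c b = \<zero>\<^bsub>K\<^esub>"
  shows "c \<in> carrier (free_module K B)"
proof -
  have "{b. c b \<noteq> \<zero>\<^bsub>K\<^esub>} \<subseteq> S" "{b. c b \<noteq> \<zero>\<^bsub>K\<^esub>} \<subseteq> B" using assms(3,4) by blast+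
  then show ?thesis
    using assms(1,2) finite_subset by (auto simp: free_module_def)
qed

context cring
begin

lemma free_module_add_closed:
  assumes "c \<in> carrier (free_module R B)" "c' \<in> carrier (free_module R B)"
  shows "(\<lambda>b. c b \<oplus> c' b) \<in> carrier (free_module R B)"
  using free_module_carrierD[OF assms(1)] free_module_carrierD[OF assms(2)]
  by (intro free_module_carrierI[where S = "{b. c b \<noteq> \<zero>} \<union> {b. c' b \<noteq> \<zero>}"]) auto

lemma free_module_minus_closed:
  assumes "c \<in> carrier (free_module R B)"
  shows "(\<lambda>b. \<ominus> c b) \<in> carrier (free_module R B)"
  using free_module_carrierD[OF assms]
  by (intro free_module_carrierI[where S = "{b. c b \<noteq> \<zero>}"]) auto

lemma free_module_zero_closed: "(\<lambda>b. \<zero>) \<in> carrier (free_module R B)"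
  by (rule free_module_carrierI[where S = "{}"]) auto

lemma free_module_smult_closed:
  assumes "a \<in> carrier R" "c \<in> carrier (free_module R B)"
  shows "(\<lambda>b. a \<otimes> c b) \<in> carrier (free_module R B)"
  using free_module_carrierD[OF assms(2)] assms(1)
  by (intro free_module_carrierI[where S = "{b. c b \<noteq> \<zero>}"]) auto

lemma abelian_group_free_module: "abelian_group (free_module R B)"
proof (rule abelian_groupI)
  fix c assume c: "c \<in> carrier (free_module R B)"
  note cD = free_module_carrierD(1)[OF c]
  show "\<zero>\<^bsub>free_module R B\<^esub> \<oplus>\<^bsub>free_module R B\<^esub> c = c"
    using cD by simp
  show "\<exists>c'\<in>carrier (free_module R B). c' \<oplus>\<^bsub>free_module R B\<^esub> c = \<zero>\<^bsub>free_module R B\<^esub>"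
    using free_module_minus_closed[OF c] cD
    by (intro bexI[of _ "\<lambda>b. \<ominus> c b"]) (auto simp: l_neg)
  fix c' assume c': "c' \<in> carrier (free_module R B)"
  note cD' = free_module_carrierD(1)[OF c']
  show "c \<oplus>\<^bsub>free_module R B\<^esub> c' = c' \<oplus>\<^bsub>free_module R B\<^esub> c"
    using cD cD' by (simp add: a_comm)
  fix c'' assume c'': "c'' \<in> carrier (free_module R B)"
  show "(c \<oplus>\<^bsub>free_module R B\<^esub> c') \<oplus>\<^bsub>free_module R B\<^esub> c''
      = c \<oplus>\<^bsub>free_module R B\<^esub> (c' \<oplus>\<^bsub>free_module R B\<^esub> c'')"
    using cD cD' free_module_carrierD(1)[OF c''] by (simp add: a_assoc)
qed (use free_module_add_closed free_module_zero_closed in auto)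

lemma free_module_subgroup:
  assumes "B' \<subseteq> B"
  shows "additive_subgroup (carrier (free_module R B')) (free_module R B)"
proof -
  interpret F: abelian_group "free_module R B" by (rule abelian_group_free_module)
  have sub: "carrier (free_module R B') \<subseteq> carrier (free_module R B)"
    using assms by (auto simp: free_module_def)
  show ?thesis
  proof (rule additive_subgroupI, rule F.add.subgroupI)
    fix c assume c: "c \<in> carrier (free_module R B')"
    have "\<ominus>\<^bsub>free_module R B\<^esub> c = (\<lambda>b. \<ominus> c b)"
      using c sub free_module_minus_closed[OF c] free_module_carrierD(1)[OF c]
      by (intro F.minus_equality) (auto simp: l_neg)
    then show "\<ominus>\<^bsub>free_module R B\<^esub> c \<in> carrier (free_module R B')"
      using free_module_minus_closed[OF c] by simp
    fix c' assume "c' \<in> carrier (free_module R B')"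
    then show "c \<oplus>\<^bsub>free_module R B\<^esub> c' \<in> carrier (free_module R B')"
      using free_module_add_closed[OF c] by simp
  qed (use sub free_module_zero_closed in auto)
qed

lemma finsum_free_module:
  assumes "finite A" "\<And>a. a \<in> A \<Longrightarrow> F a \<in> carrier (free_module R B)"
  shows "(\<Oplus>\<^bsub>free_module R B\<^esub>a\<in>A. F a) b = (\<Oplus>a\<in>A. F a b)"
    and "(\<Oplus>\<^bsub>free_module R B\<^esub>a\<in>A. F a) \<in> carrier (free_module R B)"
proof -
  interpret F: abelian_group "free_module R B" by (rule abelian_group_free_module)
  show "(\<Oplus>\<^bsub>free_module R B\<^esub>a\<in>A. F a) \<in> carrier (free_module R B)"
    using assms(2) by (intro F.finsum_closed) auto
  show "(\<Oplus>\<^bsub>free_module R B\<^esub>a\<in>A. F a) b = (\<Oplus>a\<in>A. F a b)"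
    using assms
  proof (induction A)
    case (insert a A)
    have "(\<Oplus>\<^bsub>free_module R B\<^esub>a\<in>insert a A. F a)
        = F a \<oplus>\<^bsub>free_module R B\<^esub> (\<Oplus>\<^bsub>free_module R B\<^esub>a\<in>A. F a)"
      using insert by (intro F.finsum_insert) auto
    moreover have "(\<Oplus>a\<in>insert a A. F a b) = F a b \<oplus> (\<Oplus>a\<in>A. F a b)"
      by (rule finsum_insert) (use insert free_module_carrierD(1)[of "F _" R B b] in auto)
    ultimately show ?case using insert by simp
  qed simp
qed

lemma finsum_swap:
  assumes "finite A" "finite B" "\<And>a b. a \<in> A \<Longrightarrow> b \<in> B \<Longrightarrow> h a b \<in> carrier R"
  shows "(\<Oplus>a\<in>A. \<Oplus>b\<in>B. h a b) = (\<Oplus>b\<in>B. \<Oplus>a\<in>A. h a b)"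
  using assms
proof (induction A)
  case empty
  then show ?case by simp
next
  case (insert a A)
  have "(\<Oplus>b\<in>B. \<Oplus>a\<in>insert a A. h a b) = (\<Oplus>b\<in>B. h a b \<oplus> (\<Oplus>a\<in>A. h a b))"
    using insert by (intro finsum_cong') (auto simp: Pi_def intro!: finsum_closed)
  also have "\<dots> = (\<Oplus>b\<in>B. h a b) \<oplus> (\<Oplus>b\<in>B. \<Oplus>a\<in>A. h a b)"
    using insert by (intro finsum_addf) (auto simp: Pi_def intro!: finsum_closed)
  finally show ?case
    using insert by (simp add: Pi_def)
qed

lemma pairing_eq_finsum:
  assumes "finite S" "\<And>a. a \<notin> S \<Longrightarrow> c a = \<zero>" "\<And>a. c a \<in> carrier R" "\<And>a. u a \<in> carrier R"
  shows "pairing R c u = (\<Oplus>a\<in>S. c a \<otimes> u a)"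
  unfolding pairing_def
  by (rule add.finprod_mono_neutral_cong_left) (use assms in \<open>auto simp: Pi_def\<close>)

lemma pairing_closed:
  assumes "c \<in> carrier (free_module R B)" "\<And>a. u a \<in> carrier R"
  shows "pairing R c u \<in> carrier R"
  unfolding pairing_def using free_module_carrierD(1)[OF assms(1)] assms(2)
  by (intro finsum_closed) auto

lemma pairing_cong:
  assumes "c \<in> carrier (free_module R B)" "\<And>a. a \<in> B \<Longrightarrow> w a \<in> carrier R"
    "\<And>a. a \<in> B \<Longrightarrow> u a = w a"
  shows "pairing R c u = pairing R c w"
proof -
  have "a \<in> B" if "c a \<noteq> \<zero>" for a using free_module_carrierD(3)[OF assms(1)] that by metis
  then show ?thesis
    unfolding pairing_def using free_module_carrierD(1)[OF assms(1)] assms(2,3)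
    by (intro finsum_cong') auto
qed

lemma pairing_zero_right:
  assumes "c \<in> carrier (free_module R B)"
  shows "pairing R c (\<lambda>a. \<zero>) = \<zero>"
  unfolding pairing_def using free_module_carrierD(1)[OF assms] by (simp cong: finsum_cong)

lemma pairing_zero_left: "pairing R (\<lambda>a. \<zero>) u = \<zero>"
  by (simp add: pairing_def)

lemma pairing_add_left:
  assumes c: "c \<in> carrier (free_module R B)" and c': "c' \<in> carrier (free_module R B)"
    and u: "\<And>a. u a \<in> carrier R"
  shows "pairing R (\<lambda>a. c a \<oplus> c' a) u = pairing R c u \<oplus> pairing R c' u"
proof -
  let ?S = "{b. c b \<noteq> \<zero>} \<union> {b. c' b \<noteq> \<zero>}"
  note D = free_module_carrierD[OF c] free_module_carrierD[OF c']
  have "pairing R (\<lambda>a. c a \<oplus> c' a) u = (\<Oplus>a\<in>?S. (c a \<oplus> c' a) \<otimes> u a)"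
    by (rule pairing_eq_finsum) (use D u in auto)
  also have "\<dots> = (\<Oplus>a\<in>?S. c a \<otimes> u a \<oplus> c' a \<otimes> u a)"
    by (rule finsum_cong') (use D u in \<open>auto simp: l_distr\<close>)
  also have "\<dots> = (\<Oplus>a\<in>?S. c a \<otimes> u a) \<oplus> (\<Oplus>a\<in>?S. c' a \<otimes> u a)"
    by (rule finsum_addf) (use D u in auto)
  also have "(\<Oplus>a\<in>?S. c a \<otimes> u a) = pairing R c u"
    by (rule pairing_eq_finsum[symmetric]) (use D u in auto)
  also have "(\<Oplus>a\<in>?S. c' a \<otimes> u a) = pairing R c' u"
    by (rule pairing_eq_finsum[symmetric]) (use D u in auto)
  finally show ?thesis .
qed

lemma pairing_add_right:
  assumes c: "c \<in> carrier (free_module R B)"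
    and u: "\<And>a. u a \<in> carrier R" and w: "\<And>a. w a \<in> carrier R"
  shows "pairing R c (\<lambda>a. u a \<oplus> w a) = pairing R c u \<oplus> pairing R c w"
proof -
  note D = free_module_carrierD[OF c]
  have "pairing R c (\<lambda>a. u a \<oplus> w a) = (\<Oplus>a\<in>{a. c a \<noteq> \<zero>}. c a \<otimes> u a \<oplus> c a \<otimes> w a)"
    unfolding pairing_def by (rule finsum_cong') (use D u w in \<open>auto simp: r_distr\<close>)
  also have "\<dots> = pairing R c u \<oplus> pairing R c w"
    unfolding pairing_def by (rule finsum_addf) (use D u w in auto)
  finally show ?thesis .
qed

lemma normal_indicator_closed [simp]: "normal_indicator R b y \<in> carrier R"
  by (simp add: normal_indicator_def tuple_chain_def basis_vec_def)

lemma normal_indicator_other: "y \<noteq> b \<Longrightarrow> normal_indicator R b y = \<zero>"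
  by (auto simp: normal_indicator_def tuple_chain_def basis_vec_def)

lemma normal_indicator_degenerate: "y = [] \<or> \<not> distinct_adj y \<Longrightarrow> normal_indicator R b y = \<zero>"
  by (auto simp: normal_indicator_def tuple_chain_def basis_vec_def)

lemma normal_indicator_self: "y \<noteq> [] \<Longrightarrow> distinct_adj y \<Longrightarrow> normal_indicator R y y = \<one>"
  by (auto simp: normal_indicator_def tuple_chain_def basis_vec_def)

lemma tuple_map_outside:
  assumes "c \<in> carrier (free_module R B)" "\<And>a. c a \<noteq> \<zero> \<Longrightarrow> b \<notin> snd ` set (t a)"
  shows "tuple_map R t c b = \<zero>"
proof -
  have "signed_eval R (t a) (normal_indicator R b) = \<zero>" if "c a \<noteq> \<zero>" for a
    by (rule signed_eval_zero) (metis assms(2) normal_indicator_other that)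
  then show ?thesis
    unfolding tuple_map_def pairing_def using free_module_carrierD(1)[OF assms(1)]
    by (simp cong: finsum_cong)
qed

lemma tuple_map_carrier:
  assumes c: "c \<in> carrier (free_module R B)"
    and t: "\<And>a y. a \<in> B \<Longrightarrow> y \<in> snd ` set (t a) \<Longrightarrow> y \<noteq> [] \<Longrightarrow> distinct_adj y \<Longrightarrow> y \<in> B'"
  shows "tuple_map R t c \<in> carrier (free_module R B')"
proof (rule free_module_carrierI)
  show "finite (\<Union>a\<in>{a. c a \<noteq> \<zero>}. snd ` set (t a))"
    using free_module_carrierD(2)[OF c] by simp
  show "tuple_map R t c b \<in> carrier R" for b
    unfolding tuple_map_def by (rule pairing_closed[OF c]) simp
  show zero: "tuple_map R t c b = \<zero>" if "b \<notin> (\<Union>a\<in>{a. c a \<noteq> \<zero>}. snd ` set (t a))" for b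
    by (rule tuple_map_outside[OF c]) (use that in auto)
  have "b \<in> B'" if nz: "tuple_map R t c b \<noteq> \<zero>" for b
  proof -
    obtain a where a: "c a \<noteq> \<zero>" "b \<in> snd ` set (t a)" using zero[of b] nz by blast
    have "b \<noteq> [] \<and> distinct_adj b"
    proof (rule ccontr)
      assume deg: "\<not> (b \<noteq> [] \<and> distinct_adj b)"
      have "normal_indicator R b y = \<zero>" for y
        using deg normal_indicator_other[of y b] normal_indicator_degenerate[of b b] by metis
      then have "signed_eval R (t a) (normal_indicator R b) = \<zero>" for a
        by (intro signed_eval_zero) simp
      then show False using nz pairing_zero_right[OF c] by (simp add: tuple_map_def)
    qed
    moreover have "a \<in> B" using free_module_carrierD(3)[OF c] a(1) by metis
    ultimately show ?thesis using t[OF _ a(2)] by blast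
  qed
  then show "tuple_map R t c b = \<zero>" if "b \<notin> B'" for b using that by metis
qed

lemma tuple_map_hom:
  assumes "\<And>a y. a \<in> B \<Longrightarrow> y \<in> snd ` set (t a) \<Longrightarrow> y \<noteq> [] \<Longrightarrow> distinct_adj y \<Longrightarrow> y \<in> B'"
  shows "abelian_group_hom (free_module R B) (free_module R B') (tuple_map R t)"
proof (rule additive_homI[OF abelian_group_free_module abelian_group_free_module])
  show "tuple_map R t c \<in> carrier (free_module R B')" if "c \<in> carrier (free_module R B)" for c
    by (rule tuple_map_carrier[OF that assms])
  show "tuple_map R t (c \<oplus>\<^bsub>free_module R B\<^esub> c')
      = tuple_map R t c \<oplus>\<^bsub>free_module R B'\<^esub> tuple_map R t c'"
    if "c \<in> carrier (free_module R B)" "c' \<in> carrier (free_module R B)" for c c'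
    using pairing_add_left[OF that] by (auto simp: tuple_map_def)
qed

text \<open>
  A composite of maps of this form is computed by composing the functionals: a normalized function \<open>u\<close> is
  the sum of its values times the indicators of the finitely many tuples involved, so the dual of
  \<open>tuple_map R t\<close> sends \<open>u\<close> to \<open>\<lambda>a. signed_eval R (t a) u\<close>.
\<close>
lemma pairing_tuple_map:
  assumes c: "c \<in> carrier (free_module R B)" and u: "\<And>y. u y \<in> carrier R"
    and normal: "\<And>y. y = [] \<or> \<not> distinct_adj y \<Longrightarrow> u y = \<zero>"
  shows "pairing R (tuple_map R t c) u = pairing R c (\<lambda>a. signed_eval R (t a) u)"
proof -
  let ?A = "{a. c a \<noteq> \<zero>}"
  define S where "S = (\<Union>a\<in>?A. snd ` set (t a))"
  note D = free_module_carrierD[OF c]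
  have S: "finite S" using D(2) by (simp add: S_def)
  have expand: "(\<Oplus>b\<in>S. normal_indicator R b y \<otimes> u b) = u y" if "y \<in> S" for y
  proof -
    have "(\<Oplus>b\<in>S. normal_indicator R b y \<otimes> u b) = (\<Oplus>b\<in>S. if y = b then u b else \<zero>)"
    proof (rule finsum_cong')
      fix b assume "b \<in> S"
      show "normal_indicator R b y \<otimes> u b = (if y = b then u b else \<zero>)"
        using u normal[of b] normal_indicator_other[of y b] normal_indicator_self[of y]
        by (cases "b = [] \<or> \<not> distinct_adj b") auto
    qed (use u in auto)
    also have "\<dots> = u y" using finsum_singleton[OF that S, of u] u by simp
    finally show ?thesis .
  qed
  have "pairing R (tuple_map R t c) u = (\<Oplus>b\<in>S. tuple_map R t c b \<otimes> u b)"
  proof (rule pairing_eq_finsum[OF S _ _ u])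
    show "tuple_map R t c b = \<zero>" if "b \<notin> S" for b
      by (rule tuple_map_outside[OF c]) (use that in \<open>auto simp: S_def\<close>)
    show "tuple_map R t c b \<in> carrier R" for b
      unfolding tuple_map_def by (rule pairing_closed[OF c]) simp
  qed
  also have "\<dots> = (\<Oplus>b\<in>S. \<Oplus>a\<in>?A. c a \<otimes> (signed_eval R (t a) (normal_indicator R b) \<otimes> u b))"
  proof (rule finsum_cong')
    fix b
    have "tuple_map R t c b \<otimes> u b = (\<Oplus>a\<in>?A. c a \<otimes> signed_eval R (t a) (normal_indicator R b) \<otimes> u b)"
      unfolding tuple_map_def pairing_def by (rule finsum_ldistr) (use D u in auto)
    also have "\<dots> = (\<Oplus>a\<in>?A. c a \<otimes> (signed_eval R (t a) (normal_indicator R b) \<otimes> u b))"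
      by (rule finsum_cong') (use D u in \<open>auto simp: m_assoc\<close>)
    finally show "tuple_map R t c b \<otimes> u b =
      (\<Oplus>a\<in>?A. c a \<otimes> (signed_eval R (t a) (normal_indicator R b) \<otimes> u b))" .
  qed (use D u in \<open>auto intro!: finsum_closed\<close>)
  also have "\<dots> = (\<Oplus>a\<in>?A. \<Oplus>b\<in>S. c a \<otimes> (signed_eval R (t a) (normal_indicator R b) \<otimes> u b))"
    by (rule finsum_swap) (use D u S in auto)
  also have "\<dots> = (\<Oplus>a\<in>?A. c a \<otimes> signed_eval R (t a) u)"
  proof (rule finsum_cong')
    fix a assume a: "a \<in> ?A"
    have "signed_eval R (t a) u = signed_eval R (t a) (\<lambda>y. \<Oplus>b\<in>S. u b \<otimes> normal_indicator R b y)"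
    proof (rule signed_eval_cong)
      fix y assume "y \<in> snd ` set (t a)"
      then have "y \<in> S" using a by (auto simp: S_def)
      then show "u y = (\<Oplus>b\<in>S. u b \<otimes> normal_indicator R b y)"
        using expand[of y] u by (simp add: m_comm)
    qed
    also have "\<dots> = (\<Oplus>b\<in>S. signed_eval R (t a) (\<lambda>y. u b \<otimes> normal_indicator R b y))"
      by (rule signed_eval_finsum[OF S]) (use u in auto)
    also have "\<dots> = (\<Oplus>b\<in>S. signed_eval R (t a) (normal_indicator R b) \<otimes> u b)"
      using u by (simp add: signed_eval_scale m_comm)
    finally show "(\<Oplus>b\<in>S. c a \<otimes> (signed_eval R (t a) (normal_indicator R b) \<otimes> u b)) =
        c a \<otimes> signed_eval R (t a) u"
      using D u by (simp add: finsum_rdistr[OF S] Pi_def)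
  qed (use D u in auto)
  finally show ?thesis by (simp add: pairing_def)
qed

end

section \<open>The complex of a quasimetric space\<close>

lemma delete_nth_mem_faces: "i < length xs \<Longrightarrow> delete_nth i xs \<in> snd ` set (faces xs)"
proof (induction xs arbitrary: i)
  case (Cons x xs)
  show ?case
  proof (cases i)
    case (Suc j)
    then obtain s where "(s, delete_nth j xs) \<in> set (faces xs)" using Cons by force
    then show ?thesis by (force simp: Suc delete_nth_def negated_image_def image_iff)
  qed (simp add: delete_nth_def)
qed simp

context cring
begin

text \<open>
  Splitting off the summand \<open>i = 0\<close> of the alternating sum gives the recursion that defines \<open>faces\<close>.
\<close>
lemma alternating_finsum_delete_nth:
  assumes "length xs = Suc n" "\<And>y. u y \<in> carrier R"
  shows "(\<Oplus>i\<in>{0..n}. ((\<ominus> \<one>) [^] i) \<otimes> u (delete_nth i xs)) = signed_eval R (faces xs) u"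
  using assms
proof (induction xs arbitrary: u n)
  case (Cons x xs)
  note u = Cons.prems(2)
  show ?case
  proof (cases n)
    case 0
    then show ?thesis using Cons.prems by (simp add: delete_nth_def negated_image_def)
  next
    case (Suc m)
    define e where "e = \<ominus> \<one>"
    have e: "e \<in> carrier R" by (simp add: e_def)
    let ?f = "\<lambda>i. (e [^] i) \<otimes> u (delete_nth i (x # xs))"
    have "(\<Oplus>i\<in>{0..n}. ?f i) = (\<Oplus>i\<in>{0..m}. ?f (Suc i)) \<oplus> ?f 0"
      unfolding Suc atLeast0AtMost by (rule finsum_Suc2) (use u e in auto)
    also have "(\<Oplus>i\<in>{0..m}. ?f (Suc i))
        = (\<Oplus>i\<in>{0..m}. e \<otimes> ((e [^] i) \<otimes> u (x # delete_nth i xs)))"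
      by (rule finsum_cong') (use u e in \<open>auto simp: delete_nth_def m_ac\<close>)
    also have "\<dots> = e \<otimes> (\<Oplus>i\<in>{0..m}. (e [^] i) \<otimes> u (x # delete_nth i xs))"
      by (rule finsum_rdistr[symmetric]) (use u e in auto)
    also have "(\<Oplus>i\<in>{0..m}. (e [^] i) \<otimes> u (x # delete_nth i xs))
        = signed_eval R (faces xs) (\<lambda>ys. u (x # ys))"
      unfolding e_def by (rule Cons.IH) (use u Cons.prems(1) Suc in auto)
    also have "?f 0 = u xs" using u by (simp add: delete_nth_def)
    finally have "(\<Oplus>i\<in>{0..n}. ?f i)
        = u xs \<ominus> signed_eval R (faces xs) (\<lambda>ys. u (x # ys))"
      using u by (simp add: e_def l_minus minus_eq a_comm)
    then show ?thesis
      using signed_eval_faces_Cons[of u x xs] u by (simp only: e_def)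
  qed
qed simp

lemma tuple_chain_carrier:
  assumes "distinct_adj y \<Longrightarrow> y \<in> B"
  shows "tuple_chain R y \<in> carrier (free_module R B)"
  by (rule free_module_carrierI[where S = "{y}"])
    (use assms in \<open>auto simp: tuple_chain_def basis_vec_def\<close>)

lemma linear_ext_free_module:
  assumes c: "c \<in> carrier (free_module R B)"
    and f: "\<And>a. a \<in> B \<Longrightarrow> f a \<in> carrier (free_module R B')"
  shows "linear_ext R (free_module R B') f c = (\<lambda>b. pairing R c (\<lambda>a. f a b))"
proof -
  have "a \<in> B" if "c a \<noteq> \<zero>" for a using free_module_carrierD(3)[OF c] that by metis
  then have "c a \<odot>\<^bsub>free_module R B'\<^esub> f a \<in> carrier (free_module R B')"
    if "a \<in> {a. c a \<noteq> \<zero>}" for a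
    using that free_module_smult_closed[OF free_module_carrierD(1)[OF c] f] by simp
  from finsum_free_module(1)[OF free_module_carrierD(2)[OF c] this]
  show ?thesis by (auto simp: linear_ext_def pairing_def)
qed

lemma RC_map_eq_tuple_map:
  assumes \<phi>: "\<phi> \<in> short_maps X dX Y dY" and c: "c \<in> carrier (RC_mod R X dX n)"
  shows "RC_map R Y dY \<phi> n c = tuple_map R (\<lambda>xs. [(True, map \<phi> xs)]) c"
proof -
  note c = c[unfolded RC_mod_def]
  have "RC_map R Y dY \<phi> n c = (\<lambda>b. pairing R c (\<lambda>xs. tuple_chain R (map \<phi> xs) b))"
    unfolding RC_map_def RC_mod_def
    by (rule linear_ext_free_module[OF c tuple_chain_carrier]) (rule map_tuples[OF \<phi>])
  also have "\<dots> = tuple_map R (\<lambda>xs. [(True, map \<phi> xs)]) c"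
    unfolding tuple_map_def
    by (intro ext pairing_cong[OF c])
      (auto simp: normal_indicator_def mem_tuples_iff tuple_chain_def basis_vec_def)
  finally show ?thesis .
qed

text \<open>
  This includes degree \<open>0\<close>, where the only face is the empty tuple and the indicators vanish on it.
\<close>
lemma RC_bd_eq_tuple_map:
  assumes X: "quasimetric_space X d" and c: "c \<in> carrier (RC_mod R X d n)"
  shows "RC_bd R X d n c = tuple_map R faces c"
proof (cases n)
  case 0
  have "signed_eval R (faces xs) (normal_indicator R b) = \<zero>" if "xs \<in> tuples X d n" for xs b
  proof (rule signed_eval_zero, rule normal_indicator_degenerate)
    fix y assume "y \<in> snd ` set (faces xs)"
    from faces_length[OF this] show "y = [] \<or> \<not> distinct_adj y"
      using that 0 by (simp add: mem_tuples_iff)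
  qed
  then have "tuple_map R faces c b = \<zero>" for b
    unfolding tuple_map_def
    using pairing_cong[OF c[unfolded RC_mod_def], of "\<lambda>_. \<zero>"
        "\<lambda>xs. signed_eval R (faces xs) (normal_indicator R b)"]
      pairing_zero_right[OF c[unfolded RC_mod_def]] by simp
  then show ?thesis by (auto simp: RC_bd_def RC_mod_def 0)
next
  case (Suc m)
  note c = c[unfolded RC_mod_def]
  let ?M = "free_module R (tuples X d m)"
  define F where "F xs i = ((\<ominus> \<one>) [^] i) \<odot>\<^bsub>?M\<^esub> tuple_chain R (delete_nth i xs)" for xs i
  have F: "F xs i \<in> carrier ?M" if xs: "xs \<in> tuples X d n" and i: "i \<in> {0..n}" for xs i
  proof -
    have face: "delete_nth i xs \<in> snd ` set (faces xs)" and "length (delete_nth i xs) = n"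
      using xs i delete_nth_mem_faces[of i xs] by (auto simp: mem_tuples_iff delete_nth_def)
    then have "delete_nth i xs \<noteq> []" using Suc by auto
    then have "tuple_chain R (delete_nth i xs) \<in> carrier ?M"
      using faces_tuples[OF X xs face] Suc by (intro tuple_chain_carrier) simp
    then show ?thesis
      using free_module_smult_closed[of "(\<ominus> \<one>) [^] i"] by (simp add: F_def)
  qed
  have "RC_bd R X d n c = linear_ext R ?M (\<lambda>xs. \<Oplus>\<^bsub>?M\<^esub>i\<in>{0..n}. F xs i) c"
    by (simp add: RC_bd_def RC_mod_def Suc F_def)
  also have "\<dots> = (\<lambda>b. pairing R c (\<lambda>xs. (\<Oplus>\<^bsub>?M\<^esub>i\<in>{0..n}. F xs i) b))"
    by (rule linear_ext_free_module[OF c]) (rule finsum_free_module(2), use F in auto)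
  also have "\<dots> = tuple_map R faces c"
    unfolding tuple_map_def
  proof (intro ext pairing_cong[OF c])
    fix b xs assume xs: "xs \<in> tuples X d n"
    have len: "length xs = Suc n" using xs by (simp add: mem_tuples_iff)
    have "(\<Oplus>\<^bsub>?M\<^esub>i\<in>{0..n}. F xs i) b = (\<Oplus>i\<in>{0..n}. F xs i b)"
      by (rule finsum_free_module(1)) (use F[OF xs] in auto)
    also have "\<dots> = (\<Oplus>i\<in>{0..n}. ((\<ominus> \<one>) [^] i) \<otimes> normal_indicator R b (delete_nth i xs))"
    proof (rule finsum_cong')
      fix i assume "i \<in> {0..n}"
      then have "delete_nth i xs \<noteq> []" using len Suc by (auto simp: delete_nth_def)
      then show "F xs i b = ((\<ominus> \<one>) [^] i) \<otimes> normal_indicator R b (delete_nth i xs)"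
        by (simp add: F_def normal_indicator_def)
    qed auto
    also have "\<dots> = signed_eval R (faces xs) (normal_indicator R b)"
      by (rule alternating_finsum_delete_nth[OF len]) simp
    finally show "(\<Oplus>\<^bsub>?M\<^esub>i\<in>{0..n}. F xs i) b = signed_eval R (faces xs) (normal_indicator R b)" .
  qed simp
  finally show ?thesis .
qed

lemma RC_simps:
  "ob (RC R X d) n = free_module R (tuples X d n)"
  "bd (RC R X d) n = RC_bd R X d n"
  "filt (RC R X d) s n =
     carrier (free_module R {xs \<in> tuples X d n. enn2ereal (tuple_length d xs) \<le> ereal s})"
  by (simp_all add: RC_def RC_mod_def)

lemma free_module_mono: "B \<subseteq> B' \<Longrightarrow> carrier (free_module R B) \<subseteq> carrier (free_module R B')"
  by (auto simp: free_module_def)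

lemma faces_normal:
  "y = [] \<or> \<not> distinct_adj y \<Longrightarrow> signed_eval R (faces y) (normal_indicator R b) = \<zero>"
  using faces_degenerate[of "normal_indicator R b" y] normal_indicator_degenerate by auto

lemma valid_filtered_complex_RC:
  assumes X: "quasimetric_space X d"
  shows "valid_filtered_complex (RC R X d)"
proof (intro valid_filtered_complex.intro valid_chain_complex.intro valid_filtered_complex_axioms.intro)
  note bd_eq = RC_bd_eq_tuple_map[OF X, unfolded RC_mod_def]
  have tuple_hom: "abelian_group_hom (free_module R (tuples X d n)) (free_module R (tuples X d (n - 1)))
      (tuple_map R faces)" for n
    by (rule tuple_map_hom) (rule faces_tuples[OF X])
  show "abelian_group_hom (ob (RC R X d) n) (ob (RC R X d) (n - 1)) (bd (RC R X d) n)" for n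
    unfolding RC_simps by (rule additive_hom_cong[OF tuple_hom bd_eq])
  show "bd (RC R X d) n (bd (RC R X d) (Suc n) c) = \<zero>\<^bsub>ob (RC R X d) (n - 1)\<^esub>"
    if "c \<in> carrier (ob (RC R X d) (Suc n))" for c n
  proof -
    note c = that[unfolded RC_simps]
    have "tuple_map R faces c \<in> carrier (free_module R (tuples X d n))"
      using abelian_group_hom.hom_closed[OF tuple_hom c] by simp
    then have "RC_bd R X d n (RC_bd R X d (Suc n) c) = tuple_map R faces (tuple_map R faces c)"
      using c by (simp add: bd_eq)
    moreover have "tuple_map R faces (tuple_map R faces c) b = \<zero>" for b
    proof -
      have "tuple_map R faces (tuple_map R faces c) b
          = pairing R c (\<lambda>xs. signed_eval R (faces xs)
              (\<lambda>ys. signed_eval R (faces ys) (normal_indicator R b)))"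
        unfolding tuple_map_def[of R faces "tuple_map R faces c"]
        by (rule pairing_tuple_map[OF c]) (simp_all add: faces_normal)
      then show ?thesis using pairing_zero_right[OF c] by (simp add: faces_faces)
    qed
    ultimately show ?thesis by (auto simp: RC_simps)
  qed
  show "additive_subgroup (filt (RC R X d) s n) (ob (RC R X d) n)" for s n
    unfolding RC_simps by (rule free_module_subgroup) auto
  show "filt (RC R X d) s n \<subseteq> filt (RC R X d) t n" if "s \<le> t" for s t n
    unfolding RC_simps
    by (rule free_module_mono) (use that in \<open>auto intro: order_trans\<close>)
  show "bd (RC R X d) n ` filt (RC R X d) s n \<subseteq> filt (RC R X d) s (n - 1)" for s n
  proof (intro image_subsetI)
    fix c assume c: "c \<in> filt (RC R X d) s n"
    let ?B = "\<lambda>n. {xs \<in> tuples X d n. enn2ereal (tuple_length d xs) \<le> ereal s}"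
    have "c \<in> carrier (free_module R (tuples X d n))"
      using c free_module_mono[of "?B n" "tuples X d n"] unfolding RC_simps by blast
    moreover have "tuple_map R faces c \<in> carrier (free_module R (?B (n - 1)))"
    proof (rule tuple_map_carrier)
      show "c \<in> carrier (free_module R (?B n))" using c by (simp add: RC_simps)
      fix xs y assume xs: "xs \<in> ?B n" and y: "y \<in> snd ` set (faces xs)" "y \<noteq> []" "distinct_adj y"
      have "tuple_length d y \<le> tuple_length d xs"
        using quasimetric_space.faces_tuple_length[OF X y(1)] xs by (simp add: mem_tuples_iff)
      then show "y \<in> ?B (n - 1)"
        using faces_tuples[OF X _ y] xs by (auto simp: less_eq_ennreal.rep_eq intro: order_trans)
    qed
    ultimately show "bd (RC R X d) n c \<in> filt (RC R X d) s (n - 1)"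
      by (simp add: RC_simps bd_eq del: One_nat_def)
  qed
qed

lemma filtered_map_RC_map:
  fixes \<phi> :: "'c \<Rightarrow> 'd"
  assumes X: "quasimetric_space X dX" and Y: "quasimetric_space Y dY"
    and \<phi>: "\<phi> \<in> short_maps X dX Y dY"
  shows "filtered_map (RC R X dX) (RC R Y dY) (RC_map R Y dY \<phi>)"
proof -
  interpret X: valid_filtered_complex "RC R X dX" by (rule valid_filtered_complex_RC[OF X])
  interpret Y: valid_filtered_complex "RC R Y dY" by (rule valid_filtered_complex_RC[OF Y])
  let ?t = "\<lambda>xs. [(True, map \<phi> xs)]"
  note bdX = RC_bd_eq_tuple_map[OF X, unfolded RC_mod_def]
    and bdY = RC_bd_eq_tuple_map[OF Y, unfolded RC_mod_def]
    and map_eq = RC_map_eq_tuple_map[OF \<phi>, unfolded RC_mod_def]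
  have tuple_hom: "abelian_group_hom (free_module R (tuples X dX n)) (free_module R (tuples Y dY n))
      (tuple_map R ?t)" for n
    by (rule tuple_map_hom) (auto intro: map_tuples[OF \<phi>])
  show ?thesis
  proof (intro filtered_map.intro chain_map.intro chain_map_axioms.intro filtered_map_axioms.intro
      X.valid_filtered_complex_axioms Y.valid_filtered_complex_axioms X.valid_chain_complex_axioms Y.valid_chain_complex_axioms)
    show "abelian_group_hom (ob (RC R X dX) n) (ob (RC R Y dY) n) (RC_map R Y dY \<phi> n)" for n
      unfolding RC_simps by (rule additive_hom_cong[OF tuple_hom map_eq])
    show "bd (RC R Y dY) n (RC_map R Y dY \<phi> n c) = RC_map R Y dY \<phi> (n - 1) (bd (RC R X dX) n c)"
      if "c \<in> carrier (ob (RC R X dX) n)" for c n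
    proof -
      note c = that[unfolded RC_simps]
      have "tuple_map R ?t c \<in> carrier (free_module R (tuples Y dY n))"
        by (rule abelian_group_hom.hom_closed[OF tuple_hom c])
      moreover have "RC_bd R X dX n c \<in> carrier (free_module R (tuples X dX (n - 1)))"
        using abelian_group_hom.hom_closed[OF X.bd_hom that] by (simp add: RC_simps)
      ultimately have "RC_bd R Y dY n (RC_map R Y dY \<phi> n c) = tuple_map R faces (tuple_map R ?t c)"
        "RC_map R Y dY \<phi> (n - 1) (RC_bd R X dX n c) = tuple_map R ?t (tuple_map R faces c)"
        using c by (simp_all add: map_eq bdX bdY del: One_nat_def)
      moreover have "tuple_map R faces (tuple_map R ?t c) b = tuple_map R ?t (tuple_map R faces c) b" for b
      proof -
        have "tuple_map R faces (tuple_map R ?t c) b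
            = pairing R c (\<lambda>xs. signed_eval R (?t xs) (\<lambda>ys. signed_eval R (faces ys) (normal_indicator R b)))"
          unfolding tuple_map_def[of R faces "tuple_map R ?t c"]
          by (rule pairing_tuple_map[OF c]) (simp_all add: faces_normal)
        moreover have "tuple_map R ?t (tuple_map R faces c) b
            = pairing R c (\<lambda>xs. signed_eval R (faces xs) (\<lambda>ys. signed_eval R (?t ys) (normal_indicator R b)))"
          unfolding tuple_map_def[of R ?t "tuple_map R faces c"]
        proof (rule pairing_tuple_map[OF c])
          fix y :: "'c list" assume "y = [] \<or> \<not> distinct_adj y"
          then have "map \<phi> y = [] \<or> \<not> distinct_adj (map \<phi> y)"
            using distinct_adj_mapD by auto
          from normal_indicator_degenerate[OF this]
          show "signed_eval R (?t y) (normal_indicator R b) = \<zero>" by simp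
        qed simp
        ultimately show ?thesis by (simp add: faces_map)
      qed
      ultimately show ?thesis by (auto simp: RC_simps)
    qed
    show "RC_map R Y dY \<phi> n ` filt (RC R X dX) s n \<subseteq> filt (RC R Y dY) s n" for n s
    proof (intro image_subsetI)
      fix c assume c: "c \<in> filt (RC R X dX) s n"
      let ?B = "{xs \<in> tuples X dX n. enn2ereal (tuple_length dX xs) \<le> ereal s}"
      have "c \<in> carrier (free_module R (tuples X dX n))"
        using c free_module_mono[of ?B "tuples X dX n"] unfolding RC_simps by blast
      moreover have "tuple_map R ?t c \<in> filt (RC R Y dY) s n"
        unfolding RC_simps
      proof (rule tuple_map_carrier)
        show "c \<in> carrier (free_module R ?B)" using c by (simp add: RC_simps)
        fix xs y assume xs: "xs \<in> ?B" and y: "y \<in> snd ` set (?t xs)" "y \<noteq> []" "distinct_adj y"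
        have "tuple_length dY (map \<phi> xs) \<le> tuple_length dX xs"
          using short_map_tuple_length[OF \<phi>] xs by (simp add: mem_tuples_iff)
        then show "y \<in> {xs \<in> tuples Y dY n. enn2ereal (tuple_length dY xs) \<le> ereal s}"
          using map_tuples[OF \<phi>] xs y by (auto simp: less_eq_ennreal.rep_eq intro: order_trans)
      qed
      ultimately show "RC_map R Y dY \<phi> n c \<in> filt (RC R Y dY) s n"
        by (simp add: map_eq)
    qed
  qed
qed

text \<open>
  The prism operator is a homotopy that raises the filtration by \<open>r\<close>, so the abstract criterion applies.
\<close>
lemma qm_SH_map_eq_of_map_dist_le:
  fixes \<phi> \<psi> :: "'c \<Rightarrow> 'd"
  assumes X: "quasimetric_space X dX" and Y: "quasimetric_space Y dY"
    and \<phi>: "\<phi> \<in> short_maps X dX Y dY" and \<psi>: "\<psi> \<in> short_maps X dX Y dY"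
    and r: "0 \<le> r" and le: "map_dist X dY \<phi> \<psi> \<le> ennreal r" and I: "I \<noteq> {}"
  shows "qm_SH_map R X dX Y dY r n I \<phi> = qm_SH_map R X dX Y dY r n I \<psi>"
  unfolding qm_SH_map_def
proof (rule SH_map_eq_of_homotopy[OF _ _ r I, where P = "\<lambda>_. tuple_map R (prism \<phi> \<psi>)"])
  have close: "dY (\<phi> x) (\<psi> x) \<le> ennreal r" if "x \<in> X" for x
    using le that unfolding map_dist_def by (meson SUP_upper order_trans)
  note bdX = RC_bd_eq_tuple_map[OF X, unfolded RC_mod_def]
    and bdY = RC_bd_eq_tuple_map[OF Y, unfolded RC_mod_def]
  show "filtered_map (RC R X dX) (RC R Y dY) (RC_map R Y dY \<phi>)"
    "filtered_map (RC R X dX) (RC R Y dY) (RC_map R Y dY \<psi>)"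
    by (rule filtered_map_RC_map[OF X Y], fact)+
  have prism_hom: "abelian_group_hom (free_module R (tuples X dX n)) (free_module R (tuples Y dY (Suc n)))
      (tuple_map R (prism \<phi> \<psi>))" for n
    by (rule tuple_map_hom) (rule prism_tuples[OF \<phi> \<psi> close])
  then show "abelian_group_hom (ob (RC R X dX) n) (ob (RC R Y dY) (Suc n)) (tuple_map R (prism \<phi> \<psi>))" for n
    by (simp add: RC_simps)
  show "tuple_map R (prism \<phi> \<psi>) ` filt (RC R X dX) s n \<subseteq> filt (RC R Y dY) (s + r) (Suc n)" for s n
  proof (intro image_subsetI, unfold RC_simps, rule tuple_map_carrier, assumption)
    fix xs y
    assume xs: "xs \<in> {xs \<in> tuples X dX n. enn2ereal (tuple_length dX xs) \<le> ereal s}"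
      and y: "y \<in> snd ` set (prism \<phi> \<psi> xs)" "distinct_adj y"
    have "tuple_length dY y \<le> tuple_length dX xs + ennreal r"
      by (rule prism_tuple_length[OF \<phi> \<psi> _ y(1)]) (use xs close in \<open>auto simp: mem_tuples_iff\<close>)
    then show "y \<in> {xs \<in> tuples Y dY (Suc n). enn2ereal (tuple_length dY xs) \<le> ereal (s + r)}"
      using prism_tuples[OF \<phi> \<psi> close _ y] xs enn2ereal_le_add r by blast
  qed
  fix n c
  assume c_ob: "c \<in> carrier (ob (RC R X dX) n)"
  note c = c_ob[unfolded RC_simps]
  have Pc: "tuple_map R (prism \<phi> \<psi>) c \<in> carrier (free_module R (tuples Y dY (Suc n)))"
    by (rule abelian_group_hom.hom_closed[OF prism_hom c])
  have boundary: "(if n = 0 then (\<lambda>b. \<zero>) else tuple_map R (prism \<phi> \<psi>) (RC_bd R X dX n c))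
      = tuple_map R (prism \<phi> \<psi>) (tuple_map R faces c)"
  proof (cases "n = 0")
    case True
    then have "tuple_map R faces c = (\<lambda>b. \<zero>)"
      using bdX[OF c] by (simp add: RC_bd_def RC_mod_def)
    then show ?thesis
      using True by (auto simp: tuple_map_def[of R "prism \<phi> \<psi>"] pairing_zero_left)
  qed (simp add: bdX[OF c])
  have "tuple_map R (\<lambda>xs. [(True, map \<psi> xs)]) c b = tuple_map R (\<lambda>xs. [(True, map \<phi> xs)]) c b
      \<oplus> (tuple_map R (prism \<phi> \<psi>) (tuple_map R faces c) b
         \<oplus> tuple_map R faces (tuple_map R (prism \<phi> \<psi>) c) b)" for b
  proof -
    let ?e = "normal_indicator R b"
    let ?PF = "\<lambda>xs. signed_eval R (faces xs) (\<lambda>ys. signed_eval R (prism \<phi> \<psi> ys) ?e)"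
      and ?FP = "\<lambda>xs. signed_eval R (prism \<phi> \<psi> xs) (\<lambda>ys. signed_eval R (faces ys) ?e)"
    have PF: "tuple_map R (prism \<phi> \<psi>) (tuple_map R faces c) b = pairing R c ?PF"
      unfolding tuple_map_def[of R "prism \<phi> \<psi>"]
    proof (rule pairing_tuple_map[OF c])
      fix y :: "'c list" assume y: "y = [] \<or> \<not> distinct_adj y"
      show "signed_eval R (prism \<phi> \<psi> y) ?e = \<zero>"
      proof (rule signed_eval_zero, rule normal_indicator_degenerate)
        fix z assume "z \<in> snd ` set (prism \<phi> \<psi> y)"
        then show "z = [] \<or> \<not> distinct_adj z"
          using y prism_degenerate[of y] by fastforce
      qed
    qed simp
    have FP: "tuple_map R faces (tuple_map R (prism \<phi> \<psi>) c) b = pairing R c ?FP"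
      unfolding tuple_map_def[of R faces]
      by (rule pairing_tuple_map[OF c]) (simp_all add: faces_normal)
    have "?e (map \<psi> xs) = ?e (map \<phi> xs) \<oplus> (?PF xs \<oplus> ?FP xs)" for xs
    proof -
      have "?FP xs = ?e (map \<psi> xs) \<ominus> ?e (map \<phi> xs) \<ominus> ?PF xs" by (rule faces_prism) simp
      moreover have "a = f \<oplus> (p \<oplus> (a \<ominus> f \<ominus> p))"
        if "a \<in> carrier R" "f \<in> carrier R" "p \<in> carrier R" for a f p
      proof -
        have "f \<oplus> (p \<oplus> (a \<ominus> f \<ominus> p)) = (f \<oplus> \<ominus> f) \<oplus> ((p \<oplus> \<ominus> p) \<oplus> a)"
          using that by (simp add: minus_eq a_ac)
        then show ?thesis using that by (simp add: r_neg)
      qed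
      ultimately show ?thesis by simp
    qed
    then have "tuple_map R (\<lambda>xs. [(True, map \<psi> xs)]) c b
        = pairing R c (\<lambda>xs. ?e (map \<phi> xs) \<oplus> (?PF xs \<oplus> ?FP xs))"
      by (simp add: tuple_map_def)
    also have "\<dots> = pairing R c (\<lambda>xs. ?e (map \<phi> xs)) \<oplus> (pairing R c ?PF \<oplus> pairing R c ?FP)"
      by (simp add: pairing_add_right[OF c])
    finally show ?thesis by (simp add: PF FP tuple_map_def[of R "\<lambda>xs. [(True, map \<phi> xs)]"])
  qed
  then show "RC_map R Y dY \<psi> n c = RC_map R Y dY \<phi> n c \<oplus>\<^bsub>ob (RC R Y dY) n\<^esub>
      ((if n = 0 then \<zero>\<^bsub>ob (RC R Y dY) n\<^esub> else tuple_map R (prism \<phi> \<psi>) (bd (RC R X dX) n c))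
        \<oplus>\<^bsub>ob (RC R Y dY) n\<^esub> bd (RC R Y dY) (Suc n) (tuple_map R (prism \<phi> \<psi>) c))"
    unfolding RC_simps free_module_simps boundary bdY[OF Pc]
      RC_map_eq_tuple_map[OF \<phi>, unfolded RC_mod_def, OF c]
      RC_map_eq_tuple_map[OF \<psi>, unfolded RC_mod_def, OF c]
    by blast
qed

end

section \<open>Homotopy invariance\<close>

lemma homotopy_rel_minimal:
  assumes "(\<phi>, \<psi>) \<in> homotopy_rel r X dX Y dY" and "equiv (short_maps X dX Y dY) E"
    and "\<And>\<phi> \<psi>. \<phi> \<in> short_maps X dX Y dY \<Longrightarrow> \<psi> \<in> short_maps X dX Y dY \<Longrightarrow>
      map_dist X dY \<phi> \<psi> \<le> ennreal r \<Longrightarrow> (\<phi>, \<psi>) \<in> E"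
  shows "(\<phi>, \<psi>) \<in> E"
  using assms unfolding homotopy_rel_def by blast

theorem theorem4p9:
  fixes K :: "('k, 'm) ring_scheme"
    and X :: "'a set" and dX :: "'a \<Rightarrow> 'a \<Rightarrow> ennreal"
    and Y :: "'b set" and dY :: "'b \<Rightarrow> 'b \<Rightarrow> ennreal"
    and r :: real and n :: nat and I :: "real set"
    and \<phi> \<psi> :: "'a \<Rightarrow> 'b"
  assumes "cring K"
    and "quasimetric_space X dX" and "quasimetric_space Y dY"
    and "0 \<le> r"
    and "\<phi> \<in> short_maps X dX Y dY" and "\<psi> \<in> short_maps X dX Y dY"
    and "(\<phi>, \<psi>) \<in> homotopy_rel r X dX Y dY"
    and "convex I" and "I \<noteq> {}"
  shows "qm_SH_map K X dX Y dY r n I \<phi> = qm_SH_map K X dX Y dY r n I \<psi>"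
proof -
  let ?S = "short_maps X dX Y dY"
  let ?E = "{(\<alpha>, \<beta>). \<alpha> \<in> ?S \<and> \<beta> \<in> ?S \<and>
    qm_SH_map K X dX Y dY r n I \<alpha> = qm_SH_map K X dX Y dY r n I \<beta>}"
  have "(\<phi>, \<psi>) \<in> ?E"
  proof (rule homotopy_rel_minimal[OF assms(7)])
    show "equiv ?S ?E"
      by (intro equivI refl_onI symI transI) auto
    show "(\<alpha>, \<beta>) \<in> ?E" if "\<alpha> \<in> ?S" "\<beta> \<in> ?S" "map_dist X dY \<alpha> \<beta> \<le> ennreal r" for \<alpha> \<beta>
      using that cring.qm_SH_map_eq_of_map_dist_le[OF assms(1,2,3) that(1,2) assms(4) that(3) assms(9)]
      by simp
  qed
  then show ?thesis by simp
qed

end
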